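(* Let $\Omega$, $S$, $K$ and $\widetilde\gamma_{PV},\widetilde\gamma_{SP},\widetilde\gamma_{SV}$ be as in the context, and for $h>0$, $u\in BV(\Omega;[0,1])$ let $$E_h(u)=\frac{1}{\sqrt h}\int_{\Omega}\Big[\widetilde\gamma_{PV}\,u\,K_h*(\mathbf 1_\Omega-u)+\widetilde\gamma_{SP}\,u\,K_h*\mathbf 1_S+\widetilde\gamma_{SV}\,(\mathbf 1_\Omega-u)\,K_h*\mathbf 1_S\Big]\,dx .$$ Then there exists a constant $c>0$, independent of $u$, $h$ and $N$, such that for every $u\in BV(\Omega;[0,1])$, every $h>0$ and every integer $N\ge1$, $$E_{N^2h}(u)\le(1+cN\sqrt h)\,E_h(u).$$
   Context: $\mathbb T^d=(\mathbb R/\mathbb Z)^d$, $d\ge 1$, is identified with the unit cube with periodic identification. $\Omega$ is an open, connected set of class $C^2$, compactly contained in $\mathbb T^d$ (i.e. in the open unit cube), and $S=\mathbb T^d\setminus\overline\Omega$. $BV(\Omega;[0,1])$ is the set of $BV(\Omega)$ functions with values a.e. in $[0,1]$; such functions are extended by $0$ to $\mathbb T^d\setminus\Omega$. All functions on $\mathbb T^d$ are extended periodically to $\mathbb R^d$, and convolutions with $K_h$ are over $\mathbb R^d$. The functions $\widetilde\gamma_{PV},\widetilde\gamma_{SP},\widetilde\gamma_{SV}:\mathbb T^d\to(0,\infty)$ satisfy: all three belong to $C^{0,1}(\mathbb T^d)$; $\widetilde c\le\widetilde\gamma_{PV},\widetilde\gamma_{SP},\widetilde\gamma_{SV}\le\widetilde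 C$ in $\mathbb T^d$ for some $0<\widetilde c\le\widetilde C$; and $\widetilde\gamma_{PV}\le\widetilde\gamma_{SP}+\widetilde\gamma_{SV}$, $\widetilde\gamma_{SP}\le\widetilde\gamma_{PV}+\widetilde\gamma_{SV}$, $\widetilde\gamma_{SV}\le\widetilde\gamma_{PV}+\widetilde\gamma_{SP}$ pointwise in $\mathbb T^d$. The kernel $K:\mathbb R^d\to[0,\infty)$ satisfies $K\in L^1(\mathbb R^d)$, $K(-x)=K(x)$, $\int_{\mathbb R^d}K\,dx=1$, and $|x|K(x)\le c_KK(x/2)$ for all $x$ and some $c_K>0$. Scaling: $K_h(x)=h^{-d/2}K(x/\sqrt h)$. *)

theory Defs
  imports "HOL-Analysis.Analysis"
begin

text \<open>The torus is represented by its fundamental cell \<open>[0,1)^d\<close>; a function on the torus is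
  a function on \<open>real^'n\<close> that has period 1 in every coordinate.\<close>

definition unit_cell :: "(real^'n) set" where
  "unit_cell = {x. \<forall>i. 0 \<le> x $ i \<and> x $ i < 1}"

definition periodic :: "(real^'n \<Rightarrow> real) \<Rightarrow> bool" where
  "periodic f \<longleftrightarrow> (\<forall>x i. f (x + axis i 1) = f x)"

text \<open>Only the values of \<open>f\<close> on the unit cell matter.\<close>

definition periodic_ext :: "(real^'n \<Rightarrow> real) \<Rightarrow> real^'n \<Rightarrow> real" where
  "periodic_ext f x = f (\<chi> i. frac (x $ i))"

text \<open>The class \<open>C^{0,1}\<close> of the torus. A periodic function is Lipschitz for the quotient
  metric iff it is Lipschitz on the whole space, with the same constant; boundedness is
  automatic.\<close>

definition lipschitz_torus :: "(real^'n \<Rightarrow> real) \<Rightarrow> bool" where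
  "lipschitz_torus f \<longleftrightarrow> periodic f \<and> (\<exists>L. L-lipschitz_on UNIV f)"

definition C1_map :: "(real^'n \<Rightarrow> real^'m) \<Rightarrow> bool" where
  "C1_map f \<longleftrightarrow> (\<forall>x. f differentiable (at x)) \<and> continuous_on UNIV (\<lambda>x. jacobian f (at x))"

definition gradient :: "(real^'n \<Rightarrow> real) \<Rightarrow> real^'n \<Rightarrow> real^'n" where
  "gradient g x = (\<chi> i. frechet_derivative g (at x) (axis i 1))"

definition C2_fun :: "(real^'n \<Rightarrow> real) \<Rightarrow> bool" where
  "C2_fun g \<longleftrightarrow> (\<forall>x. g differentiable (at x)) \<and> C1_map (gradient g)"

text \<open>Open sets of class \<open>C^2\<close>: near each boundary point the set is, up to a rigid motion, the
  region above the graph of a \<open>C^2\<close> function of \<open>d - 1\<close> variables. The unit vector \<open>e\<close> is the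
  vertical direction, and \<open>y - (y \<bullet> e) *\<^sub>R e\<close> is the projection of \<open>y\<close> to the hyperplane
  orthogonal to \<open>e\<close>, so only the values of \<open>g\<close> on that hyperplane are used.\<close>

definition C2_open_set :: "(real^'n) set \<Rightarrow> bool" where
  "C2_open_set \<Omega> \<longleftrightarrow> open \<Omega> \<and>
     (\<forall>x\<in>frontier \<Omega>. \<exists>r>0. \<exists>e g. norm e = 1 \<and> C2_fun g \<and>
        \<Omega> \<inter> ball x r = {y \<in> ball x r. y \<bullet> e > g (y - (y \<bullet> e) *\<^sub>R e)})"

definition divergence :: "(real^'n \<Rightarrow> real^'n) \<Rightarrow> real^'n \<Rightarrow> real" where
  "divergence \<phi> x = trace (jacobian \<phi> (at x))"

definition test_fields :: "(real^'n) set \<Rightarrow> (real^'n \<Rightarrow> real^'n) set" where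
  "test_fields \<Omega> = {\<phi>. C1_map \<phi> \<and> (\<exists>C. compact C \<and> C \<subseteq> \<Omega> \<and> (\<forall>x. x \<notin> C \<longrightarrow> \<phi> x = 0))
                        \<and> (\<forall>x. norm (\<phi> x) \<le> 1)}"

text \<open>\<open>BV(\<Omega>)\<close>: integrable functions with finite total variation.\<close>

definition BV :: "(real^'n) set \<Rightarrow> (real^'n \<Rightarrow> real) set" where
  "BV \<Omega> = {u. set_integrable lebesgue \<Omega> u \<and>
     bdd_above ((\<lambda>\<phi>. LINT x:\<Omega>|lebesgue. u x * divergence \<phi> x) ` test_fields \<Omega>)}"

definition BV01 :: "(real^'n) set \<Rightarrow> (real^'n \<Rightarrow> real) set" where
  "BV01 \<Omega> = {u \<in> BV \<Omega>. AE x in lebesgue. x \<in> \<Omega> \<longrightarrow> 0 \<le> u x \<and> u x \<le> 1}"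

definition convol :: "(real^'n \<Rightarrow> real) \<Rightarrow> (real^'n \<Rightarrow> real) \<Rightarrow> real^'n \<Rightarrow> real" where
  "convol k f x = (LINT y|lebesgue. k (x - y) * f y)"

definition scaled_kernel :: "(real^'n \<Rightarrow> real) \<Rightarrow> real \<Rightarrow> real^'n \<Rightarrow> real" where
  "scaled_kernel K h x = h powr (- real CARD('n) / 2) * K ((1 / sqrt h) *\<^sub>R x)"

text \<open>The phase \<open>S\<close> and, for functions on \<open>\<Omega>\<close>, the extension by zero. Both live on the unit
  cell and are made periodic by \<open>periodic_ext\<close> before they are convolved.\<close>

definition solid :: "(real^'n) set \<Rightarrow> (real^'n) set" where
  "solid \<Omega> = unit_cell - closure \<Omega>"

definition zero_ext :: "(real^'n) set \<Rightarrow> (real^'n \<Rightarrow> real) \<Rightarrow> real^'n \<Rightarrow> real" where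
  "zero_ext \<Omega> u x = (if x \<in> \<Omega> then u x else 0)"

definition thresholding_energy ::
  "(real^'n) set \<Rightarrow> (real^'n \<Rightarrow> real) \<Rightarrow> (real^'n \<Rightarrow> real) \<Rightarrow> (real^'n \<Rightarrow> real) \<Rightarrow> (real^'n \<Rightarrow> real) \<Rightarrow>
     real \<Rightarrow> (real^'n \<Rightarrow> real) \<Rightarrow> real" where
  "thresholding_energy \<Omega> K \<gamma>PV \<gamma>SP \<gamma>SV h u =
     1 / sqrt h * (LINT x:\<Omega>|lebesgue.
         \<gamma>PV x * u x
           * convol (scaled_kernel K h) (periodic_ext (\<lambda>y. indicator \<Omega> y - zero_ext \<Omega> u y)) x
       + \<gamma>SP x * u x * convol (scaled_kernel K h) (periodic_ext (indicator (solid \<Omega>))) x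
       + \<gamma>SV x * (1 - u x) * convol (scaled_kernel K h) (periodic_ext (indicator (solid \<Omega>))) x)"

end

theory Submission
  imports Defs
begin

text \<open>The three phases are the film \<open>u\<close>, the vapour \<open>1\<^sub>\<Omega> - u\<close> and the substrate \<open>1\<^sub>S\<close>. The \<open>C\<^sup>2\<close>
  boundary is a null set, so these functions \<open>U\<^sub>i\<close> form a partition of unity on the torus. With one
  weight \<open>w\<^sub>i\<^sub>j\<close> for each pair of phases (and \<open>0\<close> for the reversed pair), Tonelli and \<open>y = x - \<surd>h z\<close> give
  \<open>E\<^sub>h(u) = (1/r) \<integral> K(z) J\<^sub>w(r z) dz\<close>, where \<open>r = \<surd>h\<close> and
  \<open>J\<^sub>w(z) = \<Sum>\<^sub>i\<^sub>j \<integral> w\<^sub>i\<^sub>j(x) U\<^sub>i(x) U\<^sub>j(x - z) dx\<close> is an integral over the torus. As \<open>\<surd>(N\<^sup>2h) = N r\<close>, the claim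
  compares \<open>J\<^sub>w(N z)\<close> with \<open>N J\<^sub>w(z)\<close>, averaged against \<open>K\<close>.

  For constant symmetric weights that satisfy the triangle inequality, \<open>J\<close> is subadditive: insert
  \<open>1 = \<Sum>\<^sub>k U\<^sub>k(x - a)\<close> at the intermediate point and use translation invariance on the torus. Here the
  weights vary, but a shift by \<open>a\<close> changes a Lipschitz weight by at most \<open>L |a|\<close>, which costs
  \<open>L |a| G(b)\<close>, where \<open>G\<close> is the interaction with weight \<open>1\<close> for every pair of distinct phases
  (\<open>interaction_subadditive\<close>). Summing \<open>N\<close> such steps costs \<open>O(N\<^sup>2 |z| G(z))\<close>. The weights \<open>w\<close> are not
  symmetric, but \<open>J\<^sub>w(z) + J\<^sub>w(-z)\<close> differs from the interaction with the weights \<open>w\<^sub>i\<^sub>j + w\<^sub>j\<^sub>i\<close> by an error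
  of the same kind (\<open>symmetric_interaction_multiple\<close>), and \<open>z\<close> and \<open>-z\<close> have equal mass under the
  even kernel.

  It remains to absorb \<open>\<integral> |z| K(z) G(r z) dz\<close>. The decay of \<open>K\<close> bounds it by
  \<open>c\<^sub>K \<integral> K(z/2) G(r z) dz = c\<^sub>K 2\<^sup>d \<integral> K(z) G(2 r z) dz\<close>; then \<open>G(2 y) \<le> 2 G(y)\<close>, and \<open>c\<^sub>0 G(y)\<close> is at most
  \<open>J\<^sub>w(y) + J\<^sub>w(-y)\<close>, because the tensions are bounded below. So the error is a multiple of the energy itself
  (\<open>kernel_interaction_dilation\<close>), and the constant depends only on \<open>d\<close>, \<open>L\<close>, \<open>c\<^sub>K\<close> and \<open>c\<^sub>0\<close>.\<close>

section \<open>Integration over the torus\<close>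

text \<open>Lebesgue measure on the torus, as a density instead of a restriction so that its \<open>\<sigma>\<close>-algebra
  is that of all Borel sets.\<close>
definition cell_measure :: "(real^'n) measure" where
  "cell_measure = density lborel (indicator unit_cell)"

definition integer_lattice :: "(real^'n) set" where
  "integer_lattice = {m. \<forall>i. m $ i \<in> \<int>}"

definition lattice_periodic :: "(real^'n \<Rightarrow> 'a) \<Rightarrow> bool" where
  "lattice_periodic f \<longleftrightarrow> (\<forall>x. \<forall>m\<in>integer_lattice. f (x + m) = f x)"

definition frac_vec :: "real^'n \<Rightarrow> real^'n" where
  "frac_vec x = (\<chi> i. frac (x $ i))"

lemma periodic_ext_frac_vec: "periodic_ext f x = f (frac_vec x)"
  by (simp add: periodic_ext_def frac_vec_def)

lemma frac_vec_in_unit_cell: "frac_vec x \<in> unit_cell"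
  by (simp add: frac_vec_def unit_cell_def frac_lt_1)

lemma frac_vec_unit_cell: "x \<in> unit_cell \<Longrightarrow> frac_vec x = x"
  by (simp add: frac_vec_def unit_cell_def vec_eq_iff frac_eq)

lemma frac_vec_add_lattice:
  assumes "m \<in> integer_lattice"
  shows "frac_vec (x + m) = frac_vec x"
proof -
  have "frac (x $ i + m $ i) = frac (x $ i)" for i
  proof -
    obtain k where "m $ i = of_int k"
      using assms by (auto simp: integer_lattice_def elim: Ints_cases)
    then show ?thesis by (simp add: frac_def)
  qed
  then show ?thesis by (simp add: frac_vec_def)
qed

lemma frac_vec_diff: "frac_vec x - x \<in> integer_lattice"
  by (simp add: frac_vec_def integer_lattice_def frac_def)

lemma uminus_integer_lattice: "m \<in> integer_lattice \<Longrightarrow> - m \<in> integer_lattice"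
  by (simp add: integer_lattice_def)

lemma countable_integer_lattice: "countable (integer_lattice :: (real^'n) set)"
proof -
  have "countable (PiE (UNIV :: 'n set) (\<lambda>_. \<int> :: real set))"
    by (intro countable_PiE) (auto simp: Ints_def)
  then have "countable (vec_lambda ` PiE (UNIV :: 'n set) (\<lambda>_. \<int> :: real set))"
    by (rule countable_image)
  moreover have "integer_lattice \<subseteq> vec_lambda ` PiE (UNIV :: 'n set) (\<lambda>_. \<int> :: real set)"
  proof
    fix m :: "real^'n" assume "m \<in> integer_lattice"
    then show "m \<in> vec_lambda ` PiE (UNIV :: 'n set) (\<lambda>_. \<int> :: real set)"
      by (intro image_eqI[of _ _ "vec_nth m"]) (auto simp: integer_lattice_def)
  qed
  ultimately show ?thesis by (rule countable_subset[rotated])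
qed

lemma frac_vec_measurable [measurable]: "(frac_vec :: real^'n \<Rightarrow> real^'n) \<in> borel_measurable borel"
proof -
  have "(\<lambda>x :: real^'n. x $ i) \<in> borel_measurable borel" for i
    by (intro borel_measurable_continuous_onI continuous_intros)
  then have "(\<lambda>x :: real^'n. frac_vec x \<bullet> axis i 1) \<in> borel_measurable borel" for i
    unfolding frac_vec_def frac_def by (simp add: inner_axis)
  then show ?thesis
    by (subst borel_measurable_euclidean_space) (auto simp: Basis_vec_def)
qed

lemma unit_cell_borel [measurable]: "(unit_cell :: (real^'n) set) \<in> sets borel"
proof -
  have [measurable]: "(\<lambda>x :: real^'n. x $ i) \<in> borel_measurable borel" for i
    by (intro borel_measurable_continuous_onI continuous_intros)
  have "Measurable.pred borel (\<lambda>x :: real^'n. \<forall>i. 0 \<le> x $ i \<and> x $ i < 1)"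
    by measurable
  then show ?thesis by (simp add: unit_cell_def pred_def)
qed

lemma bounded_unit_cell: "bounded (unit_cell :: (real^'n) set)"
  by (rule bounded_subset[OF bounded_cbox[of 0 1]])
     (simp add: unit_cell_def mem_box_cart subset_iff less_imp_le)

lemma sets_cell_measure [measurable_cong, simp]: "sets cell_measure = sets borel"
  by (simp add: cell_measure_def)

lemma space_cell_measure [simp]: "space cell_measure = UNIV"
  by (simp add: cell_measure_def)

lemma finite_measure_cell: "finite_measure (cell_measure :: (real^'n) measure)"
proof
  have "emeasure lborel (unit_cell :: (real^'n) set) < \<infinity>"
    using bounded_unit_cell by (rule emeasure_bounded_finite)
  then show "emeasure cell_measure (space (cell_measure :: (real^'n) measure)) \<noteq> \<infinity>"
    by (simp add: cell_measure_def emeasure_density)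
qed

lemma nn_integral_cell:
  "f \<in> borel_measurable borel \<Longrightarrow>
     (\<integral>\<^sup>+x. f x \<partial>cell_measure) = (\<integral>\<^sup>+x. indicator unit_cell x * f x \<partial>lborel)"
  unfolding cell_measure_def by (rule nn_integral_density) auto

lemma integral_cell:
  fixes f :: "real^'n \<Rightarrow> real"
  assumes "f \<in> borel_measurable borel"
  shows "(\<integral>x. f x \<partial>cell_measure) = (\<integral>x. indicator unit_cell x * f x \<partial>lborel)"
proof -
  have "(cell_measure :: (real^'n) measure)
      = density lborel (\<lambda>x. ennreal (indicator unit_cell x :: real))"
    by (simp add: cell_measure_def ennreal_indicator)
  then show ?thesis
    using integral_density[of f lborel "indicator unit_cell :: real^'n \<Rightarrow> real"] assms by simp
qed

lemma nn_integral_lborel_translate: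
  fixes f :: "'a::euclidean_space \<Rightarrow> ennreal"
  assumes "f \<in> borel_measurable borel"
  shows "(\<integral>\<^sup>+x. f (x + c) \<partial>lborel) = (\<integral>\<^sup>+x. f x \<partial>lborel)"
proof -
  have "(\<integral>\<^sup>+x. f x \<partial>lborel) = (\<integral>\<^sup>+x. f x \<partial>distr lborel borel ((+) c))"
    by (simp add: lborel_distr_plus)
  also have "\<dots> = (\<integral>\<^sup>+x. f (c + x) \<partial>lborel)"
    by (rule nn_integral_distr) (use assms in auto)
  finally show ?thesis by (simp add: add.commute)
qed

lemma unit_cell_translates_partition:
  fixes y :: "real^'n"
  shows "(\<integral>\<^sup>+m. indicator unit_cell (y + m) \<partial>count_space integer_lattice) = 1"
proof -
  have "y + m \<in> unit_cell \<longleftrightarrow> m = frac_vec y - y" if "m \<in> integer_lattice" for m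
    using frac_vec_unit_cell[of "y + m"] frac_vec_add_lattice[OF that, of y]
      frac_vec_in_unit_cell[of y] by (auto simp: algebra_simps)
  then have "(\<integral>\<^sup>+m. indicator unit_cell (y + m) \<partial>count_space integer_lattice) =
    (\<integral>\<^sup>+m. indicator {frac_vec y - y} m \<partial>count_space integer_lattice)"
    by (intro nn_integral_cong) (auto simp: indicator_def)
  also have "\<dots> = 1"
    using frac_vec_diff[of y] by (subst nn_integral_indicator) (auto simp: emeasure_count_space)
  finally show ?thesis .
qed

text \<open>Each point has exactly one lattice translate in the cell. Inserting this partition of unity and
  moving each summand by its lattice vector exchanges the cell and its translate.\<close>
lemma nn_integral_cell_translate:
  fixes f :: "real^'n \<Rightarrow> ennreal"
  assumes [measurable]: "f \<in> borel_measurable borel" and per: "lattice_periodic f"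
  shows "(\<integral>\<^sup>+x. f (x - a) \<partial>cell_measure) = (\<integral>\<^sup>+x. f x \<partial>cell_measure)"
proof -
  let ?I = "\<lambda>x :: real^'n. indicator unit_cell x :: ennreal"
  let ?C = "count_space (integer_lattice :: (real^'n) set)"
  have "(\<integral>\<^sup>+x. f (x - a) \<partial>cell_measure) = (\<integral>\<^sup>+x. ?I x * f (x - a) \<partial>lborel)"
    by (rule nn_integral_cell) measurable
  also have "\<dots> = (\<integral>\<^sup>+y. ?I (y + a) * f y \<partial>lborel)"
    using nn_integral_lborel_translate[of "\<lambda>x. ?I x * f (x - a)" a] by simp
  also have "\<dots> = (\<integral>\<^sup>+y. \<integral>\<^sup>+m. ?I (y + m) * (?I (y + a) * f y) \<partial>?C \<partial>lborel)"
    by (simp add: nn_integral_multc unit_cell_translates_partition)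
  also have "\<dots> = (\<integral>\<^sup>+m. \<integral>\<^sup>+y. ?I (y + m) * (?I (y + a) * f y) \<partial>lborel \<partial>?C)"
    by (rule nn_integral_count_space_nn_integral[OF countable_integer_lattice]) measurable
  also have "\<dots> = (\<integral>\<^sup>+m. \<integral>\<^sup>+y. ?I (y + a - m) * (?I y * f y) \<partial>lborel \<partial>?C)"
  proof (rule nn_integral_cong)
    fix m assume "m \<in> space ?C"
    then have "f (y - m) = f y" for y
      using per uminus_integer_lattice[of m] unfolding lattice_periodic_def
      by (metis add_uminus_conv_diff space_count_space)
    then show "(\<integral>\<^sup>+y. ?I (y + m) * (?I (y + a) * f y) \<partial>lborel) =
        (\<integral>\<^sup>+y. ?I (y + a - m) * (?I y * f y) \<partial>lborel)"
      using nn_integral_lborel_translate[of "\<lambda>y. ?I (y + m) * (?I (y + a) * f y)" "- m"]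
      by (simp add: algebra_simps)
  qed
  also have "\<dots> = (\<integral>\<^sup>+y. \<integral>\<^sup>+m. ?I (y + a - m) * (?I y * f y) \<partial>?C \<partial>lborel)"
    by (rule nn_integral_count_space_nn_integral[OF countable_integer_lattice, symmetric]) measurable
  also have "\<dots> = (\<integral>\<^sup>+y. ?I y * f y \<partial>lborel)"
  proof -
    have "(\<integral>\<^sup>+m. ?I (y + a - m) \<partial>?C) = 1" for y
    proof -
      have "bij_betw uminus (integer_lattice :: (real^'n) set) integer_lattice"
        by (rule bij_betwI[of _ _ _ uminus]) (auto intro: uminus_integer_lattice)
      from nn_integral_bij_count_space[OF this, of "\<lambda>m. ?I (y + a + m)"]
      show ?thesis using unit_cell_translates_partition[of "y + a"] by simp
    qed
    then show ?thesis by (simp add: nn_integral_multc)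
  qed
  also have "\<dots> = (\<integral>\<^sup>+x. f x \<partial>cell_measure)"
    by (rule nn_integral_cell[symmetric]) measurable
  finally show ?thesis .
qed

lemma integral_cell_translate:
  fixes f :: "real^'n \<Rightarrow> real"
  assumes [measurable]: "f \<in> borel_measurable borel" and "lattice_periodic f" and "\<And>x. 0 \<le> f x"
  shows "(\<integral>x. f (x - a) \<partial>cell_measure) = (\<integral>x. f x \<partial>cell_measure)"
proof -
  have "lattice_periodic (\<lambda>x. ennreal (f x))"
    using assms(2) by (simp add: lattice_periodic_def)
  then show ?thesis
    using nn_integral_cell_translate[of "\<lambda>x. ennreal (f x)" a] assms(3)
    by (simp add: integral_eq_nn_integral)
qed

lemma lattice_periodic_periodic_ext: "lattice_periodic (periodic_ext f)"
  by (simp add: lattice_periodic_def periodic_ext_frac_vec frac_vec_add_lattice)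

lemma periodic_imp_lattice_periodic:
  fixes f :: "real^'n \<Rightarrow> real"
  assumes "periodic f"
  shows "lattice_periodic f"
proof -
  have nat: "f (x + of_nat k *\<^sub>R axis i 1) = f x" for x i k
  proof (induction k)
    case (Suc k)
    have "f (x + of_nat (Suc k) *\<^sub>R axis i 1) = f ((x + of_nat k *\<^sub>R axis i 1) + axis i 1)"
      by (simp add: scaleR_add_left add.assoc add.commute[of "axis i 1"])
    also have "\<dots> = f x" using assms Suc by (simp add: periodic_def)
    finally show ?case .
  qed simp
  have int: "f (x + of_int k *\<^sub>R axis i 1) = f x" for x i k
  proof (cases k)
    case (nonneg n)
    then show ?thesis using nat by simp
  next
    case (neg n)
    then show ?thesis
      using nat[of "x + of_int k *\<^sub>R axis i 1" "Suc n" i]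
      by (simp only: add.assoc scaleR_add_left[symmetric]) simp
  qed
  have "f (x + m) = f x" if m: "m \<in> integer_lattice" for x m
  proof -
    have sub: "f (x + (\<Sum>i\<in>A. (m $ i) *\<^sub>R axis i 1)) = f x" if "finite A" for A
      using that
    proof (induction A)
      case (insert i A)
      obtain k where k: "m $ i = of_int k"
        using m by (auto simp: integer_lattice_def elim: Ints_cases)
      show ?case
        using int[of "x + (\<Sum>i\<in>A. (m $ i) *\<^sub>R axis i 1)" k i] insert k
        by (simp add: add.assoc add.commute[of "of_int k *\<^sub>R axis i 1"])
    qed simp
    have "(\<Sum>i\<in>UNIV. (m $ i) *\<^sub>R axis i 1) = m"
      using basis_expansion[of m] by (simp add: scalar_mult_eq_scaleR)
    then show ?thesis using sub[of UNIV] by simp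
  qed
  then show ?thesis by (simp add: lattice_periodic_def)
qed

text \<open>The exceptional set of the extensions is a countable union of translates of the one in the
  cell.\<close>
lemma AE_periodic_ext:
  fixes f g :: "real^'n \<Rightarrow> real"
  assumes "AE x in lebesgue. x \<in> unit_cell \<longrightarrow> f x = g x"
  shows "AE x in lebesgue. periodic_ext f x = periodic_ext g x"
proof -
  let ?N = "{x \<in> unit_cell. f x \<noteq> g x}"
  obtain N where N: "N \<in> null_sets lebesgue" "?N \<subseteq> N"
    using assms by (auto simp: eventually_ae_filter)
  then have "negligible ?N"
    by (meson negligible_iff_null_sets negligible_subset)
  then have "negligible ((+) (- m) ` ?N)" for m
    by (rule negligible_translation)
  then have "negligible (\<Union>m\<in>integer_lattice. (+) (- m) ` ?N)"
    by (intro negligible_countable_Union countable_image countable_integer_lattice) auto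
  moreover have "{x. periodic_ext f x \<noteq> periodic_ext g x} \<subseteq> (\<Union>m\<in>integer_lattice. (+) (- m) ` ?N)"
  proof
    fix x assume "x \<in> {x. periodic_ext f x \<noteq> periodic_ext g x}"
    then have "frac_vec x \<in> ?N" by (simp add: periodic_ext_frac_vec frac_vec_in_unit_cell)
    then have "x \<in> (+) (- (frac_vec x - x)) ` ?N" by (intro image_eqI[of _ _ "frac_vec x"]) auto
    then show "x \<in> (\<Union>m\<in>integer_lattice. (+) (- m) ` ?N)" using frac_vec_diff[of x] by blast
  qed
  ultimately have "negligible {x. periodic_ext f x \<noteq> periodic_ext g x}"
    by (rule negligible_subset)
  then show ?thesis by (auto simp: eventually_ae_filter negligible_iff_null_sets)
qed

section \<open>Subadditivity of phase interactions\<close>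

lemma lattice_periodic_minus:
  assumes "lattice_periodic f"
  shows "lattice_periodic (\<lambda>x. f (x - a))"
  unfolding lattice_periodic_def
proof (intro allI ballI)
  fix x m :: "real^'a" assume "m \<in> integer_lattice"
  then have "f ((x - a) + m) = f (x - a)" using assms by (simp add: lattice_periodic_def)
  then show "f (x + m - a) = f (x - a)" by (simp add: algebra_simps)
qed

lemma lattice_periodic_mult:
  fixes f g :: "real^'n \<Rightarrow> real"
  shows "lattice_periodic f \<Longrightarrow> lattice_periodic g \<Longrightarrow> lattice_periodic (\<lambda>x. f x * g x)"
  by (simp add: lattice_periodic_def)

text \<open>For three independent random phases with distributions \<open>p\<close>, \<open>q\<close>, \<open>r\<close> this is the average of the
  triangle inequality from the first to the third through the second.\<close>
lemma triangle_average:
  fixes d :: "'k \<Rightarrow> 'k \<Rightarrow> real"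
  assumes "finite I"
    and nonneg: "\<And>i. 0 \<le> p i" "\<And>i. 0 \<le> q i" "\<And>i. 0 \<le> r i"
    and sum: "(\<Sum>i\<in>I. p i) = 1" "(\<Sum>i\<in>I. q i) = 1" "(\<Sum>i\<in>I. r i) = 1"
    and tri: "\<And>i j k. i \<in> I \<Longrightarrow> j \<in> I \<Longrightarrow> k \<in> I \<Longrightarrow> d i j \<le> d i k + d k j"
  shows "(\<Sum>i\<in>I. \<Sum>j\<in>I. d i j * p i * r j) \<le>
    (\<Sum>i\<in>I. \<Sum>j\<in>I. d i j * p i * q j) + (\<Sum>i\<in>I. \<Sum>j\<in>I. d i j * q i * r j)"
proof -
  have "(\<Sum>i\<in>I. \<Sum>j\<in>I. d i j * p i * r j) = (\<Sum>i\<in>I. \<Sum>j\<in>I. \<Sum>k\<in>I. d i j * (p i * r j * q k))"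
    by (simp add: sum_distrib_left[symmetric] sum mult.assoc)
  also have "\<dots> \<le> (\<Sum>i\<in>I. \<Sum>j\<in>I. \<Sum>k\<in>I. (d i k + d k j) * (p i * r j * q k))"
    by (intro sum_mono mult_right_mono tri mult_nonneg_nonneg nonneg)
  also have "\<dots> = (\<Sum>i\<in>I. \<Sum>j\<in>I. \<Sum>k\<in>I. d i k * p i * q k * r j) +
      (\<Sum>i\<in>I. \<Sum>j\<in>I. \<Sum>k\<in>I. p i * (d k j * q k * r j))"
    by (simp add: sum.distrib[symmetric] algebra_simps)
  also have "(\<Sum>i\<in>I. \<Sum>j\<in>I. \<Sum>k\<in>I. d i k * p i * q k * r j) = (\<Sum>i\<in>I. \<Sum>k\<in>I. d i k * p i * q k)"
    by (simp add: sum_distrib_right[symmetric] sum_distrib_left[symmetric] sum)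
  also have "(\<Sum>i\<in>I. \<Sum>j\<in>I. \<Sum>k\<in>I. p i * (d k j * q k * r j)) = (\<Sum>j\<in>I. \<Sum>k\<in>I. d k j * q k * r j)"
    by (simp add: sum_distrib_left[symmetric] sum_distrib_right[symmetric] sum)
  also have "\<dots> = (\<Sum>k\<in>I. \<Sum>j\<in>I. d k j * q k * r j)"
    by (rule sum.swap)
  finally show ?thesis .
qed

locale torus_phases =
  fixes I :: "'k set" and U :: "'k \<Rightarrow> real^'n \<Rightarrow> real"
  assumes finite_phases [simp]: "finite I"
    and phase_borel [measurable]: "\<And>i. U i \<in> borel_measurable borel"
    and phase_periodic: "\<And>i. lattice_periodic (U i)"
    and phase_nonneg: "\<And>i x. 0 \<le> U i x"
    and phase_le_1: "\<And>i x. U i x \<le> 1"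
    and phase_sum: "\<And>x. (\<Sum>i\<in>I. U i x) = 1"
begin

text \<open>The regularity that makes all interaction integrals finite and translation invariant.\<close>
definition admissible :: "('k \<Rightarrow> 'k \<Rightarrow> real^'n \<Rightarrow> real) \<Rightarrow> bool" where
  "admissible w \<longleftrightarrow> (\<forall>i j. w i j \<in> borel_measurable borel \<and> lattice_periodic (w i j) \<and>
     (\<forall>x. 0 \<le> w i j x) \<and> (\<exists>B. \<forall>x. w i j x \<le> B))"

lemma admissibleD:
  assumes "admissible w"
  shows "w i j \<in> borel_measurable borel" "lattice_periodic (w i j)" "0 \<le> w i j x"
  using assms by (auto simp: admissible_def)

text \<open>The weighted amount of pairs of points at displacement \<open>z\<close>, the second point at \<open>x - z\<close> as in a
  convolution.\<close>
definition interaction :: "('k \<Rightarrow> 'k \<Rightarrow> real^'n \<Rightarrow> real) \<Rightarrow> real^'n \<Rightarrow> real" where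
  "interaction w z = (\<Sum>i\<in>I. \<Sum>j\<in>I. \<integral>x. w i j x * U i x * U j (x - z) \<partial>cell_measure)"

text \<open>The interaction with these weights measures all error terms. It is subadditive without an error of
  its own, because the weights do not depend on the point.\<close>
definition distinct_weight :: "'k \<Rightarrow> 'k \<Rightarrow> real^'n \<Rightarrow> real" where
  "distinct_weight i j x = (if i = j then 0 else 1)"

lemma admissible_distinct_weight: "admissible distinct_weight"
  by (auto simp: admissible_def distinct_weight_def[abs_def] lattice_periodic_def
      intro!: exI[of _ 1])

lemma admissible_transpose_shift:
  assumes "admissible w"
  shows "admissible (\<lambda>i j x. w j i (x - a))"
  unfolding admissible_def
proof (intro allI conjI)
  fix i j x
  show "(\<lambda>x. w j i (x - a)) \<in> borel_measurable borel"
    using admissibleD(1)[OF assms, measurable] by measurable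
  show "lattice_periodic (\<lambda>x. w j i (x - a))"
    using admissibleD(2)[OF assms] by (rule lattice_periodic_minus)
  show "0 \<le> w j i (x - a)" by (rule admissibleD(3)[OF assms])
  show "\<exists>B. \<forall>x. w j i (x - a) \<le> B" using assms by (meson admissible_def)
qed

lemma admissible_add:
  assumes "admissible v" "admissible w"
  shows "admissible (\<lambda>i j x. v i j x + w i j x)"
  using assms unfolding admissible_def lattice_periodic_def
  by (auto intro!: borel_measurable_add) (meson add_mono)

lemma admissible_scale:
  assumes "admissible w" "0 \<le> c"
  shows "admissible (\<lambda>i j x. c * w i j x)"
  using assms unfolding admissible_def lattice_periodic_def
  by (auto intro!: borel_measurable_times) (meson mult_left_mono)

lemma integrable_weighted_pair:
  assumes w: "admissible w"
  shows "integrable cell_measure (\<lambda>x. w i j x * U k (x - a) * U l (x - b))"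
proof -
  obtain B where B: "\<And>x. w i j x \<le> B" using w unfolding admissible_def by blast
  note [measurable] = admissibleD(1)[OF w]
  have "norm (w i j x * U k (x - a) * U l (x - b)) \<le> B" for x
  proof -
    have "w i j x * U k (x - a) * U l (x - b) \<le> w i j x * 1 * 1"
      by (intro mult_mono phase_le_1) (auto intro: admissibleD(3)[OF w] phase_nonneg)
    then show ?thesis
      using B[of x] admissibleD(3)[OF w, of i j x] by (simp add: phase_nonneg)
  qed
  then show ?thesis
    by (intro finite_measure.integrable_const_bound[OF finite_measure_cell]) auto
qed

lemma integrable_pair:
  assumes "admissible w"
  shows "integrable cell_measure (\<lambda>x. w i j x * U i x * U j (x - z))"
  using integrable_weighted_pair[OF assms, of i j i 0] by simp

lemma interaction_nonneg: "admissible w \<Longrightarrow> 0 \<le> interaction w z"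
  unfolding interaction_def
  by (intro sum_nonneg Bochner_Integration.integral_nonneg mult_nonneg_nonneg)
     (auto intro: admissibleD phase_nonneg)

lemma interaction_mono:
  assumes "admissible v" "admissible w"
    and "\<And>i j x. i \<in> I \<Longrightarrow> j \<in> I \<Longrightarrow> v i j x \<le> w i j x"
  shows "interaction v z \<le> interaction w z"
  unfolding interaction_def
  by (intro sum_mono integral_mono integrable_pair assms mult_right_mono)
     (auto intro: phase_nonneg)

lemma interaction_add:
  assumes "admissible v" "admissible w"
  shows "interaction (\<lambda>i j x. v i j x + w i j x) z = interaction v z + interaction w z"
  unfolding interaction_def
  by (simp add: distrib_right sum.distrib Bochner_Integration.integral_add integrable_pair assms)

lemma interaction_scale:
  "interaction (\<lambda>i j x. c * w i j x) z = c * interaction w z"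
  unfolding interaction_def by (simp add: mult.assoc sum_distrib_left)

lemma interaction_le_perturbed:
  assumes v: "admissible v" and w: "admissible w" and "0 \<le> M"
    and "\<And>i j x. i \<in> I \<Longrightarrow> j \<in> I \<Longrightarrow> v i j x \<le> w i j x + M * distinct_weight i j x"
  shows "interaction v z \<le> interaction w z + M * interaction distinct_weight z"
proof -
  have M: "admissible (\<lambda>i j x. M * distinct_weight i j x)"
    using admissible_distinct_weight \<open>0 \<le> M\<close> by (rule admissible_scale)
  have "interaction v z \<le> interaction (\<lambda>i j x. w i j x + M * distinct_weight i j x) z"
    by (intro interaction_mono admissible_add v w M assms)
  then show ?thesis by (simp add: interaction_add w M interaction_scale)
qed

text \<open>Translating the integral by \<open>z\<close> moves the second point back to \<open>x\<close>, so the two phases exchange their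
  roles and the weight is read off at the shifted point.\<close>
lemma interaction_uminus:
  assumes "admissible w"
  shows "interaction w (- z) = interaction (\<lambda>i j x. w j i (x - z)) z"
proof -
  note [measurable] = admissibleD(1)[OF assms]
  have "(\<integral>x. w i j x * U i x * U j (x - - z) \<partial>cell_measure) =
      (\<integral>x. w i j (x - z) * U j x * U i (x - z) \<partial>cell_measure)" for i j
  proof -
    let ?f = "\<lambda>x. w i j x * U i x * U j (x - - z)"
    have "lattice_periodic ?f"
      by (intro lattice_periodic_mult lattice_periodic_minus phase_periodic admissibleD(2)[OF assms])
    then have "(\<integral>x. ?f (x - z) \<partial>cell_measure) = (\<integral>x. ?f x \<partial>cell_measure)"
      by (intro integral_cell_translate)
         (auto intro!: mult_nonneg_nonneg admissibleD(3)[OF assms] phase_nonneg)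
    then show ?thesis by (simp add: algebra_simps)
  qed
  then show ?thesis
    unfolding interaction_def by (subst sum.swap) simp
qed

lemma interaction_translated:
  assumes w: "admissible w"
  shows "(\<Sum>i\<in>I. \<Sum>j\<in>I. \<integral>x. w i j x * U i (x - a) * U j (x - a - b) \<partial>cell_measure) =
    interaction (\<lambda>i j x. w i j (x + a)) b"
proof -
  note [measurable] = admissibleD(1)[OF w]
  have "(\<integral>x. w i j x * U i (x - a) * U j (x - a - b) \<partial>cell_measure) =
      (\<integral>x. w i j (x + a) * U i x * U j (x - b) \<partial>cell_measure)" for i j
  proof -
    let ?f = "\<lambda>x. w i j (x - - a) * U i x * U j (x - b)"
    have "lattice_periodic ?f"
      by (intro lattice_periodic_mult lattice_periodic_minus phase_periodic admissibleD(2)[OF w])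
    then have "(\<integral>x. ?f (x - a) \<partial>cell_measure) = (\<integral>x. ?f x \<partial>cell_measure)"
      by (intro integral_cell_translate)
         (auto intro!: mult_nonneg_nonneg admissibleD(3)[OF w] phase_nonneg)
    then show ?thesis by simp
  qed
  then show ?thesis by (simp add: interaction_def)
qed

text \<open>The phase at the intermediate point \<open>x - a\<close> splits the displacement \<open>a + b\<close>. The weight of the
  second half is still evaluated at \<open>x\<close>, so that, seen from its own base point \<open>x - a\<close>, it is shifted.\<close>
lemma interaction_triangle_step:
  assumes w: "admissible w"
    and tri: "\<And>i j k x. i \<in> I \<Longrightarrow> j \<in> I \<Longrightarrow> k \<in> I \<Longrightarrow> w i j x \<le> w i k x + w k j x"
  shows "interaction w (a + b) \<le> interaction w a + interaction (\<lambda>i j x. w i j (x + a)) b"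
proof -
  have int: "integrable cell_measure (\<lambda>x. w i j x * U i x * U j (x - a))"
    "integrable cell_measure (\<lambda>x. w i j x * U i x * U j (x - a - b))"
    "integrable cell_measure (\<lambda>x. w i j x * U i (x - a) * U j (x - a - b))" for i j
    using integrable_pair[OF w, of i j a] integrable_pair[OF w, of i j "a + b"]
      integrable_weighted_pair[OF w, of i j i a j "a + b"] by (simp_all add: algebra_simps)
  have "interaction w (a + b) =
      (\<integral>x. (\<Sum>i\<in>I. \<Sum>j\<in>I. w i j x * U i x * U j (x - a - b)) \<partial>cell_measure)"
    unfolding interaction_def
    by (simp add: Bochner_Integration.integral_sum int diff_diff_eq[symmetric])
  also have "\<dots> \<le> (\<integral>x. (\<Sum>i\<in>I. \<Sum>j\<in>I. w i j x * U i x * U j (x - a)) +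
     (\<Sum>i\<in>I. \<Sum>j\<in>I. w i j x * U i (x - a) * U j (x - a - b)) \<partial>cell_measure)"
    by (intro integral_mono Bochner_Integration.integrable_add Bochner_Integration.integrable_sum
          int triangle_average phase_nonneg phase_sum tri finite_phases)
  also have "\<dots> = interaction w a + interaction (\<lambda>i j x. w i j (x + a)) b"
    unfolding interaction_translated[OF w, symmetric]
    unfolding interaction_def
    by (simp add: Bochner_Integration.integral_sum Bochner_Integration.integral_add int)
  finally show ?thesis .
qed

text \<open>Moving the shifted weight of the second half back to its own base point costs the error term.\<close>
lemma interaction_subadditive:
  assumes w: "admissible w" and "0 \<le> L"
    and tri: "\<And>i j k x. i \<in> I \<Longrightarrow> j \<in> I \<Longrightarrow> k \<in> I \<Longrightarrow> w i j x \<le> w i k x + w k j x"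
    and lip: "\<And>i j x y. i \<in> I \<Longrightarrow> j \<in> I \<Longrightarrow>
      w i j x \<le> w i j y + L * norm (x - y) * distinct_weight i j x"
  shows "interaction w (a + b) \<le>
    interaction w a + interaction w b + L * norm a * interaction distinct_weight b"
proof -
  have "admissible (\<lambda>i j x. w i j (x + a))"
    using admissible_transpose_shift[OF admissible_transpose_shift[OF w, of 0], of "- a"] by simp
  moreover have "w i j (x + a) \<le> w i j x + L * norm a * distinct_weight i j x"
    if "i \<in> I" "j \<in> I" for i j x
    using lip[OF that, of "x + a" x] by (simp add: distinct_weight_def)
  ultimately have "interaction (\<lambda>i j x. w i j (x + a)) b \<le>
      interaction w b + L * norm a * interaction distinct_weight b"
    using w \<open>0 \<le> L\<close> by (intro interaction_le_perturbed) auto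
  then show ?thesis using interaction_triangle_step[OF w tri, of a b] by simp
qed

lemma interaction_distinct_subadditive:
  "interaction distinct_weight (a + b) \<le>
    interaction distinct_weight a + interaction distinct_weight b"
  using interaction_subadditive[OF admissible_distinct_weight, of 0 a b]
  by (simp add: distinct_weight_def)

lemma interaction_distinct_multiple:
  "interaction distinct_weight (real N *\<^sub>R z) \<le> real N * interaction distinct_weight z"
  if "N \<ge> 1"
  using that
proof (induction N rule: nat_induct_at_least)
  case (Suc N)
  then show ?case
    using interaction_distinct_subadditive[of "real N *\<^sub>R z" z]
    by (simp add: algebra_simps)
qed simp

text \<open>The \<open>n\<close>-th step of size \<open>z\<close> starts at distance \<open>n |z|\<close>, so that the errors sum to
  \<open>N (N - 1) / 2\<close> times the error of a shift by \<open>z\<close>; \<open>N\<^sup>2\<close> is a convenient bound for this factor.\<close>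
lemma interaction_multiple:
  assumes w: "admissible w" and L: "0 \<le> L"
    and tri: "\<And>i j k x. i \<in> I \<Longrightarrow> j \<in> I \<Longrightarrow> k \<in> I \<Longrightarrow> w i j x \<le> w i k x + w k j x"
    and lip: "\<And>i j x y. i \<in> I \<Longrightarrow> j \<in> I \<Longrightarrow>
      w i j x \<le> w i j y + L * norm (x - y) * distinct_weight i j x"
    and "N \<ge> 1"
  shows "interaction w (real N *\<^sub>R z) \<le>
    real N * interaction w z + L * (real N)\<^sup>2 * norm z * interaction distinct_weight z"
  using \<open>N \<ge> 1\<close>
proof (induction N rule: nat_induct_at_least)
  case base
  show ?case using L by (simp add: interaction_nonneg admissible_distinct_weight)
next
  case (Suc N)
  let ?D = "L * norm z * interaction distinct_weight z"
  have D: "0 \<le> ?D" using L by (simp add: interaction_nonneg admissible_distinct_weight)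
  have "interaction w (real (Suc N) *\<^sub>R z) = interaction w (real N *\<^sub>R z + z)"
    by (simp add: algebra_simps)
  also have "\<dots> \<le> interaction w (real N *\<^sub>R z) + interaction w z + real N * ?D"
    using interaction_subadditive[OF w L tri lip, of "real N *\<^sub>R z" z] by (simp add: algebra_simps)
  also have "\<dots> \<le> real N * interaction w z + (real N)\<^sup>2 * ?D + interaction w z + real N * ?D"
    using Suc.IH by (simp add: algebra_simps)
  also have "\<dots> \<le> real (Suc N) * interaction w z + (real (Suc N))\<^sup>2 * ?D"
  proof -
    have "((real N)\<^sup>2 + real N) * ?D \<le> (real (Suc N))\<^sup>2 * ?D"
      using D by (intro mult_right_mono) (auto simp: power2_eq_square algebra_simps)
    then show ?thesis by (simp add: algebra_simps)
  qed
  finally show ?case by (simp add: algebra_simps)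
qed

end

text \<open>The weights \<open>w\<close> need not be symmetric: each surface tension \<open>w\<^sub>i\<^sub>j + w\<^sub>j\<^sub>i\<close> may be attached to one order
  of its pair. The Lipschitz bound carries the factor \<open>distinct_weight\<close> to make the diagonal weights constant.
  The lower bound asks for one of the two orders instead of the sum, since \<open>w\<^sub>i\<^sub>j\<close> and
  \<open>w\<^sub>j\<^sub>i\<close> will be evaluated at different points.\<close>
locale lipschitz_tensions = torus_phases I U
  for I :: "'k set" and U :: "'k \<Rightarrow> real^'n \<Rightarrow> real" +
  fixes w :: "'k \<Rightarrow> 'k \<Rightarrow> real^'n \<Rightarrow> real" and L c0 :: real
  assumes admissible_w: "admissible w"
    and c0_pos: "0 < c0"
    and L_nonneg: "0 \<le> L"
    and w_lipschitz: "\<And>i j x y. w i j x \<le> w i j y + L * norm (x - y) * distinct_weight i j x"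
    and w_lower: "\<And>i j. i \<in> I \<Longrightarrow> j \<in> I \<Longrightarrow> i \<noteq> j \<Longrightarrow>
      (\<forall>x. c0 \<le> w i j x) \<or> (\<forall>x. c0 \<le> w j i x)"
    and w_triangle: "\<And>i j k x. i \<in> I \<Longrightarrow> j \<in> I \<Longrightarrow> k \<in> I \<Longrightarrow>
      w i j x + w j i x \<le> (w i k x + w k i x) + (w k j x + w j k x)"
begin

abbreviation tension :: "'k \<Rightarrow> 'k \<Rightarrow> real^'n \<Rightarrow> real" where
  "tension i j x \<equiv> w i j x + w j i x"

lemma admissible_w_flip: "admissible (\<lambda>i j x. w j i (x - a))"
  by (rule admissible_transpose_shift[OF admissible_w])

lemma admissible_tension: "admissible tension"
  using admissible_add[OF admissible_w admissible_w_flip[of 0]] by simp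

text \<open>An even kernel sees only this even part of the interaction. It differs from the interaction with symmetric
  weights \<open>tension\<close> by the point where the transposed weight is evaluated.\<close>
definition symmetric_interaction :: "real^'n \<Rightarrow> real" where
  "symmetric_interaction z = interaction w z + interaction w (- z)"

lemma symmetric_interaction_eq:
  "symmetric_interaction z = interaction (\<lambda>i j x. w i j x + w j i (x - z)) z"
  unfolding symmetric_interaction_def interaction_uminus[OF admissible_w]
  by (rule interaction_add[symmetric]) (rule admissible_w admissible_w_flip)+

lemma symmetric_interaction_le_tension:
  "symmetric_interaction z \<le>
    interaction tension z + L * norm z * interaction distinct_weight z"
  unfolding symmetric_interaction_eq
proof (rule interaction_le_perturbed)
  show "w i j x + w j i (x - z) \<le> tension i j x + L * norm z * distinct_weight i j x" for i j x
    using w_lipschitz[of j i "x - z" x] by (simp add: distinct_weight_def split: if_splits)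
qed (auto intro: admissible_add admissible_w admissible_w_flip admissible_tension L_nonneg
    mult_nonneg_nonneg)

lemma tension_le_symmetric_interaction:
  "interaction tension z \<le>
    symmetric_interaction z + L * norm z * interaction distinct_weight z"
  unfolding symmetric_interaction_eq
proof (rule interaction_le_perturbed)
  show "tension i j x \<le> w i j x + w j i (x - z) + L * norm z * distinct_weight i j x" for i j x
    using w_lipschitz[of j i x "x - z"] by (simp add: distinct_weight_def split: if_splits)
qed (auto intro: admissible_add admissible_w admissible_w_flip admissible_tension L_nonneg
    mult_nonneg_nonneg)

lemma distinct_le_symmetric_interaction:
  "c0 * interaction distinct_weight z \<le> symmetric_interaction z"
  unfolding symmetric_interaction_eq interaction_scale[symmetric]
proof (rule interaction_mono)
  fix i j x assume ij: "i \<in> I" "j \<in> I"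
  show "c0 * distinct_weight i j x \<le> w i j x + w j i (x - z)"
    using w_lower[OF ij] admissibleD(3)[OF admissible_w, of i j x]
      admissibleD(3)[OF admissible_w, of j i "x - z"]
    by (auto simp: distinct_weight_def add_increasing add_increasing2)
qed (use c0_pos in \<open>auto intro: admissible_add admissible_w admissible_w_flip
      admissible_scale admissible_distinct_weight\<close>)

text \<open>Of the constant \<open>4\<close>, two come from the Lipschitz constant \<open>2 L\<close> of the tensions, one from passing
  to symmetric weights at \<open>N z\<close> and one from returning to \<open>w\<close> at \<open>z\<close>.\<close>
lemma symmetric_interaction_multiple:
  assumes "N \<ge> 1"
  shows "symmetric_interaction (real N *\<^sub>R z) \<le>
    real N * symmetric_interaction z + 4 * L * (real N)\<^sup>2 * norm z * interaction distinct_weight z"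
proof -
  let ?D = "L * norm z * interaction distinct_weight z"
  have D: "0 \<le> ?D"
    using L_nonneg by (simp add: interaction_nonneg admissible_distinct_weight)
  have "symmetric_interaction (real N *\<^sub>R z) \<le> interaction tension (real N *\<^sub>R z) +
      L * (real N * norm z) * interaction distinct_weight (real N *\<^sub>R z)"
    using symmetric_interaction_le_tension[of "real N *\<^sub>R z"] by simp
  also have "\<dots> \<le> interaction tension (real N *\<^sub>R z) +
      L * (real N * norm z) * (real N * interaction distinct_weight z)"
    using interaction_distinct_multiple[OF assms, of z] L_nonneg
    by (intro add_left_mono mult_left_mono) auto
  also have "\<dots> = interaction tension (real N *\<^sub>R z) + (real N)\<^sup>2 * ?D"
    by (simp add: power2_eq_square algebra_simps)
  also have "interaction tension (real N *\<^sub>R z) \<le>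
      real N * interaction tension z + 2 * L * (real N)\<^sup>2 * norm z * interaction distinct_weight z"
  proof (rule interaction_multiple)
    show "tension i j x \<le> tension i j y + 2 * L * norm (x - y) * distinct_weight i j x" for i j x y
      using w_lipschitz[of i j x y] w_lipschitz[of j i x y]
      by (simp add: distinct_weight_def split: if_splits)
    show "tension i j x \<le> tension i k x + tension k j x"
      if "i \<in> I" "j \<in> I" "k \<in> I" for i j k x
      using w_triangle[OF that] by simp
  qed (use assms L_nonneg admissible_tension in auto)
  also have "real N * interaction tension z \<le> real N * (symmetric_interaction z + ?D)"
    using tension_le_symmetric_interaction[of z] by (intro mult_left_mono) auto
  also have "real N * (symmetric_interaction z + ?D) \<le>
      real N * symmetric_interaction z + (real N)\<^sup>2 * ?D"
  proof -
    have "real N * ?D \<le> (real N)\<^sup>2 * ?D"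
      using assms D by (intro mult_right_mono) (auto simp: power2_eq_square)
    then show ?thesis by (simp add: algebra_simps)
  qed
  finally show ?thesis by (simp add: algebra_simps)
qed

end

section \<open>Averaging against the kernel\<close>

lemma AE_lborel_affine:
  fixes t :: "'a::euclidean_space"
  assumes "AE x in lborel. P x" and "c \<noteq> 0"
  shows "AE x in lborel. P (t + c *\<^sub>R x)"
proof -
  obtain N where N: "N \<in> null_sets lborel" "{x. \<not> P x} \<subseteq> N"
    using assms(1) by (auto simp: eventually_ae_filter)
  have [measurable]: "N \<in> sets borel" using N(1) by auto
  have "AE x in lborel. x \<notin> N" using N(1) by (rule AE_not_in)
  then have "AE x in density (distr lborel borel (\<lambda>x. t + c *\<^sub>R x)) (\<lambda>_. \<bar>c\<bar>^DIM('a)). x \<notin> N"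
    by (simp only: lborel_affine[OF \<open>c \<noteq> 0\<close>, of t, symmetric])
  then have "AE x in distr lborel borel (\<lambda>x. t + c *\<^sub>R x). x \<notin> N"
    using \<open>c \<noteq> 0\<close> by (subst (asm) AE_density) auto
  then have "AE x in lborel. t + c *\<^sub>R x \<notin> N"
    by (subst (asm) AE_distr_iff) auto
  then show ?thesis by eventually_elim (use N(2) in auto)
qed

lemma integral_lborel_affine:
  fixes f :: "'a::euclidean_space \<Rightarrow> real"
  assumes [measurable]: "f \<in> borel_measurable borel" and "c \<noteq> 0"
  shows "(\<integral>x. f x \<partial>lborel) = \<bar>c\<bar> ^ DIM('a) * (\<integral>x. f (t + c *\<^sub>R x) \<partial>lborel)"
proof -
  have "(\<integral>x. f x \<partial>lborel) =
      (\<integral>x. f x \<partial>density (distr lborel borel (\<lambda>x. t + c *\<^sub>R x)) (\<lambda>_. ennreal (\<bar>c\<bar>^DIM('a))))"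
    using lborel_affine[OF \<open>c \<noteq> 0\<close>, of t] by simp
  also have "\<dots> = \<bar>c\<bar> ^ DIM('a) * (\<integral>x. f (t + c *\<^sub>R x) \<partial>lborel)"
    by (subst integral_density) (auto simp: integral_distr)
  finally show ?thesis .
qed

lemma integrable_lborel_affine:
  fixes f :: "'a::euclidean_space \<Rightarrow> real"
  assumes [measurable]: "f \<in> borel_measurable borel" and "c \<noteq> 0"
    and "integrable lborel f"
  shows "integrable lborel (\<lambda>x. f (t + c *\<^sub>R x))"
proof -
  have "integrable (density (distr lborel borel (\<lambda>x. t + c *\<^sub>R x))
      (\<lambda>_. ennreal (\<bar>c\<bar>^DIM('a)))) f"
    using lborel_affine[OF \<open>c \<noteq> 0\<close>, of t] assms(3) by simp
  then have "integrable (distr lborel borel (\<lambda>x. t + c *\<^sub>R x)) (\<lambda>x. \<bar>c\<bar>^DIM('a) * f x)"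
    by (subst (asm) integrable_density) auto
  then have "integrable (distr lborel borel (\<lambda>x. t + c *\<^sub>R x)) f"
    using \<open>c \<noteq> 0\<close> by simp
  then show ?thesis by (subst (asm) integrable_distr_eq) auto
qed

lemma lebesgue_integral_eq_lborel_AE:
  fixes f g :: "'a::euclidean_space \<Rightarrow> real"
  assumes g: "g \<in> borel_measurable borel" and ae: "AE x in lebesgue. f x = g x"
  shows "(\<integral>x. f x \<partial>lebesgue) = (\<integral>x. g x \<partial>lborel)"
proof -
  have g': "g \<in> borel_measurable lebesgue" using g by (simp add: measurable_completion)
  have "AE x in lebesgue. g x = f x" using ae by eventually_elim simp
  then have "f \<in> borel_measurable lebesgue"
    by (rule borel_measurable_AE[OF g'])
  then have "(\<integral>x. f x \<partial>lebesgue) = (\<integral>x. g x \<partial>lebesgue)"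
    using ae g' by (intro integral_cong_AE) auto
  also have "\<dots> = (\<integral>x. g x \<partial>lborel)" using g by (intro integral_completion) simp
  finally show ?thesis .
qed

text \<open>The substitution \<open>y = x - \<surd>h z\<close>, whose Jacobian cancels the normalisation of the scaled kernel. It also
  replaces both factors by Borel representatives, since Tonelli is applied to Borel functions.\<close>
lemma convol_scaled_kernel:
  fixes K k f g :: "real^'n \<Rightarrow> real"
  assumes [measurable]: "k \<in> borel_measurable borel" "g \<in> borel_measurable borel"
    and K: "AE x in lborel. K x = k x" and f: "AE x in lborel. f x = g x"
    and "0 < h"
  shows "convol (scaled_kernel K h) f x = (\<integral>z. k z * g (x - sqrt h *\<^sub>R z) \<partial>lborel)"
proof -
  let ?n = "CARD('n)" and ?r = "sqrt h"
  let ?s = "h powr (- real ?n / 2)"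
  have r: "0 < ?r" using \<open>0 < h\<close> by simp
  have "AE y in lborel. K ((1 / ?r) *\<^sub>R x + (- 1 / ?r) *\<^sub>R y) = k ((1 / ?r) *\<^sub>R x + (- 1 / ?r) *\<^sub>R y)"
    using r by (intro AE_lborel_affine[OF K]) auto
  with f have "AE y in lborel. scaled_kernel K h (x - y) * f y
      = ?s * k ((1 / ?r) *\<^sub>R (x - y)) * g y"
    by eventually_elim (simp add: scaled_kernel_def algebra_simps)
  then have "convol (scaled_kernel K h) f x
      = (\<integral>y. ?s * k ((1 / ?r) *\<^sub>R (x - y)) * g y \<partial>lborel)"
    unfolding convol_def by (intro lebesgue_integral_eq_lborel_AE) (auto intro: AE_completion)
  also have "\<dots> = ?r ^ ?n * (\<integral>z. ?s * k z * g (x - ?r *\<^sub>R z) \<partial>lborel)"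
    using r integral_lborel_affine[of "\<lambda>y. ?s * k ((1 / ?r) *\<^sub>R (x - y)) * g y" "- ?r" x]
    by simp
  also have "\<dots> = (?r ^ ?n * ?s) * (\<integral>z. k z * g (x - ?r *\<^sub>R z) \<partial>lborel)"
    by (simp add: mult.assoc)
  also have "?r ^ ?n * ?s = 1"
    using \<open>0 < h\<close> by (simp add: powr_half_sqrt[symmetric] powr_realpow[symmetric] powr_powr powr_add[symmetric])
  finally show ?thesis by simp
qed

lemma (in torus_phases) interaction_measurable:
  assumes "admissible w"
  shows "interaction w \<in> borel_measurable borel"
proof -
  note [measurable] = admissibleD(1)[OF assms]
  interpret cell: finite_measure "cell_measure :: (real^'n) measure" by (rule finite_measure_cell)
  have "(\<lambda>z. \<integral>x. w i j x * U i x * U j (x - z) \<partial>cell_measure) \<in> borel_measurable borel" for i j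
    by measurable
  then show ?thesis unfolding interaction_def[abs_def] by (intro borel_measurable_sum)
qed

text \<open>Dropping the second phase gives a bound that does not depend on \<open>z\<close>.\<close>
lemma (in torus_phases) interaction_bounded:
  assumes "admissible w"
  obtains B where "\<And>z. interaction w z \<le> B"
proof
  show "interaction w z \<le> (\<Sum>i\<in>I. \<Sum>j\<in>I. \<integral>x. w i j x * U i x \<partial>cell_measure)" for z
    unfolding interaction_def
  proof (intro sum_mono integral_mono integrable_pair assms)
    fix i j x
    show "w i j x * U i x * U j (x - z) \<le> w i j x * U i x"
      using mult_left_mono[OF phase_le_1[of j "x - z"], of "w i j x * U i x"]
      by (simp add: phase_nonneg admissibleD(3)[OF assms])
    \<comment> \<open>Since the phases sum to one, the integrand without a second phase is a sum of pair integrands.\<close>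
    have "integrable cell_measure (\<lambda>x. \<Sum>k\<in>I. w i j x * U i x * U k (x - 0))"
      by (intro Bochner_Integration.integrable_sum)
         (use integrable_weighted_pair[OF assms, of i j i 0 _ 0] in simp)
    then show "integrable cell_measure (\<lambda>x. w i j x * U i x)"
      by (simp add: sum_distrib_left[symmetric] phase_sum)
  qed
qed

text \<open>The kernel conditions hold only almost everywhere, so that a Borel representative of a Lebesgue
  measurable kernel can be used.\<close>
locale thresholding = lipschitz_tensions I U w L c0
  for I :: "'k set" and U :: "'k \<Rightarrow> real^'n \<Rightarrow> real" and w L c0 +
  fixes k :: "real^'n \<Rightarrow> real" and cK :: real
  assumes k_borel [measurable]: "k \<in> borel_measurable borel"
    and k_integrable: "integrable lborel k"
    and k_nonneg: "\<And>x. 0 \<le> k x"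
    and k_even: "AE x in lborel. k (- x) = k x"
    and cK_nonneg: "0 \<le> cK"
    and k_decay: "AE x in lborel. norm x * k x \<le> cK * k ((1/2) *\<^sub>R x)"
begin

lemma integrable_kernel_interaction:
  assumes "admissible v" and [measurable]: "g \<in> borel_measurable borel"
  shows "integrable lborel (\<lambda>z. k z * interaction v (g z))"
proof -
  obtain B where B: "\<And>z. interaction v z \<le> B" using interaction_bounded[OF assms(1)] by blast
  have [measurable]: "interaction v \<in> borel_measurable borel"
    by (rule interaction_measurable[OF assms(1)])
  have "integrable lborel (\<lambda>z. B * k z)" using k_integrable by simp
  then show ?thesis
  proof (rule Bochner_Integration.integrable_bound)
    show "AE z in lborel. norm (k z * interaction v (g z)) \<le> norm (B * k z)"
    proof (rule AE_I2)
      fix z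
      have "0 \<le> B" using B[of 0] interaction_nonneg[OF assms(1), of 0] by simp
      then show "norm (k z * interaction v (g z)) \<le> norm (B * k z)"
        using mult_left_mono[OF B[of "g z"] k_nonneg[of z]]
        by (simp add: abs_mult interaction_nonneg[OF assms(1)] k_nonneg mult.commute)
    qed
  qed measurable
qed

text \<open>Tonelli turns the average of interactions back into convolutions.\<close>
lemma kernel_interaction_eq:
  assumes v: "admissible v"
  shows "(\<integral>z. k z * interaction v (r *\<^sub>R z) \<partial>lborel) =
    (\<integral>x. (\<Sum>i\<in>I. \<Sum>j\<in>I. v i j x * U i x * (\<integral>z. k z * U j (x - r *\<^sub>R z) \<partial>lborel)) \<partial>cell_measure)"
proof -
  note [measurable] = admissibleD(1)[OF v]
  interpret cell: finite_measure "cell_measure :: (real^'n) measure" by (rule finite_measure_cell)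
  interpret pair_sigma_finite "lborel :: (real^'n) measure" "cell_measure :: (real^'n) measure" ..
  let ?f = "\<lambda>i j z x. k z * (v i j x * U i x * U j (x - r *\<^sub>R z))"
  have nonneg: "0 \<le> v i j x * U i x * U j y" for i j x y
    by (intro mult_nonneg_nonneg phase_nonneg admissibleD(3)[OF v])
  have prod: "integrable (lborel \<Otimes>\<^sub>M cell_measure) (case_prod (?f i j))" if "i \<in> I" "j \<in> I" for i j
  proof (rule Fubini_integrable)
    show "AE z in lborel. integrable cell_measure (\<lambda>x. case_prod (?f i j) (z, x))"
      by (simp add: integrable_pair[OF v])
    have "integrable lborel (\<lambda>z. k z * interaction v (r *\<^sub>R z))"
      by (rule integrable_kernel_interaction[OF v]) measurable
    then show "integrable lborel (\<lambda>z. \<integral>x. norm (case_prod (?f i j) (z, x)) \<partial>cell_measure)"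
    proof (rule Bochner_Integration.integrable_bound)
      have "(\<integral>x. v i j x * U i x * U j (x - r *\<^sub>R z) \<partial>cell_measure) \<le> interaction v (r *\<^sub>R z)" for z
      proof -
        have ge: "0 \<le> (\<integral>x. v i j x * U i x * U j (x - r *\<^sub>R z) \<partial>cell_measure)" for i j
          by (intro Bochner_Integration.integral_nonneg nonneg)
        have "(\<integral>x. v i j x * U i x * U j (x - r *\<^sub>R z) \<partial>cell_measure) \<le>
            (\<Sum>j\<in>I. \<integral>x. v i j x * U i x * U j (x - r *\<^sub>R z) \<partial>cell_measure)"
          using that ge by (intro member_le_sum) auto
        also have "\<dots> \<le> interaction v (r *\<^sub>R z)"
          unfolding interaction_def
          using that ge by (intro member_le_sum sum_nonneg) auto
        finally show ?thesis .
      qed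
      then show "AE z in lborel. norm (\<integral>x. norm (case_prod (?f i j) (z, x)) \<partial>cell_measure)
          \<le> norm (k z * interaction v (r *\<^sub>R z))"
        by (intro AE_I2)
           (simp add: abs_mult k_nonneg phase_nonneg admissibleD(3)[OF v] interaction_nonneg[OF v]
             Bochner_Integration.integral_nonneg mult_left_mono)
    qed measurable
  qed measurable
  have int: "integrable cell_measure (\<lambda>x. \<integral>z. ?f i j z x \<partial>lborel)" if "i \<in> I" "j \<in> I" for i j
    using integrable_snd[OF prod[OF that]] .
  have "(\<integral>z. k z * interaction v (r *\<^sub>R z) \<partial>lborel) =
      (\<integral>z. (\<Sum>i\<in>I. \<Sum>j\<in>I. \<integral>x. ?f i j z x \<partial>cell_measure) \<partial>lborel)"
    unfolding interaction_def by (simp add: sum_distrib_left)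
  also have "\<dots> = (\<Sum>i\<in>I. \<Sum>j\<in>I. \<integral>z. \<integral>x. ?f i j z x \<partial>cell_measure \<partial>lborel)"
    using integrable_fst[OF prod]
    by (subst Bochner_Integration.integral_sum, force)
       (intro sum.cong refl Bochner_Integration.integral_sum, force)
  also have "\<dots> = (\<Sum>i\<in>I. \<Sum>j\<in>I. \<integral>x. \<integral>z. ?f i j z x \<partial>lborel \<partial>cell_measure)"
    by (intro sum.cong refl Fubini_integral[OF prod, symmetric])
  also have "\<dots> = (\<integral>x. (\<Sum>i\<in>I. \<Sum>j\<in>I. \<integral>z. ?f i j z x \<partial>lborel) \<partial>cell_measure)"
    by (simp add: Bochner_Integration.integral_sum int)
  also have "\<dots> = (\<integral>x. (\<Sum>i\<in>I. \<Sum>j\<in>I. v i j x * U i x * (\<integral>z. k z * U j (x - r *\<^sub>R z) \<partial>lborel)) \<partial>cell_measure)"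
    by (simp add: mult.left_commute[of "k _"])
  finally show ?thesis .
qed

lemma kernel_symmetric_interaction:
  "(\<integral>z. k z * symmetric_interaction (r *\<^sub>R z) \<partial>lborel) =
    2 * (\<integral>z. k z * interaction w (r *\<^sub>R z) \<partial>lborel)"
proof -
  have [measurable]: "interaction w \<in> borel_measurable borel"
    by (rule interaction_measurable[OF admissible_w])
  have "(\<integral>z. k z * interaction w (- (r *\<^sub>R z)) \<partial>lborel) =
      (\<integral>z. k (- z) * interaction w (r *\<^sub>R z) \<partial>lborel)"
    using integral_lborel_affine[of "\<lambda>z. k z * interaction w (- (r *\<^sub>R z))" "- 1" 0] by simp
  also have "\<dots> = (\<integral>z. k z * interaction w (r *\<^sub>R z) \<partial>lborel)"
    using k_even by (intro integral_cong_AE) (auto elim: eventually_mono)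
  finally have "(\<integral>z. k z * interaction w (- (r *\<^sub>R z)) \<partial>lborel) =
    (\<integral>z. k z * interaction w (r *\<^sub>R z) \<partial>lborel)" .
  then show ?thesis
    unfolding symmetric_interaction_def
    by (simp add: distrib_left Bochner_Integration.integral_add
          integrable_kernel_interaction[OF admissible_w])
qed

text \<open>The decay of the kernel trades the factor \<open>norm z\<close> of the error for a kernel of twice the width, and
  subadditivity takes this width back. So the error is controlled by the averaged interaction at
  scale \<open>r\<close> itself.\<close>
lemma kernel_interaction_dilation:
  assumes "0 \<le> r" and "N \<ge> 1"
  shows "(\<integral>z. k z * interaction w ((real N * r) *\<^sub>R z) \<partial>lborel) \<le>
    (real N + 8 * L * cK * 2 ^ CARD('n) / c0 * (real N)\<^sup>2 * r) *
      (\<integral>z. k z * interaction w (r *\<^sub>R z) \<partial>lborel)"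
proof -
  let ?G = "interaction distinct_weight" and ?n = "CARD('n)"
  have [measurable]: "interaction w \<in> borel_measurable borel" "?G \<in> borel_measurable borel"
    by (rule interaction_measurable admissible_w admissible_distinct_weight)+
  have [measurable]: "symmetric_interaction \<in> borel_measurable borel"
    unfolding symmetric_interaction_def[abs_def] by measurable
  let ?S = "\<lambda>s. \<integral>z. k z * symmetric_interaction (s *\<^sub>R z) \<partial>lborel"
  have int_S: "integrable lborel (\<lambda>z. k z * symmetric_interaction (s *\<^sub>R z))" for s
    unfolding symmetric_interaction_def distrib_left
    by (intro Bochner_Integration.integrable_add integrable_kernel_interaction[OF admissible_w])
       measurable
  have int_G: "integrable lborel (\<lambda>z. k z * ?G (s *\<^sub>R z))" for s
    by (intro integrable_kernel_interaction[OF admissible_distinct_weight]) measurable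
  have int_half: "integrable lborel (\<lambda>z. k ((1/2) *\<^sub>R z) * ?G (r *\<^sub>R z))"
    using integrable_lborel_affine[OF _ _ int_G[of "2 * r"], of "1/2" 0] by simp
  define E where "E = 4 * L * (real N)\<^sup>2 * r * cK"
  have E: "0 \<le> E" using L_nonneg cK_nonneg assms by (simp add: E_def)
  have "(\<integral>z. k ((1/2) *\<^sub>R z) * ?G (r *\<^sub>R z) \<partial>lborel) =
      2 ^ ?n * (\<integral>z. k z * ?G ((2 * r) *\<^sub>R z) \<partial>lborel)"
    using integral_lborel_affine[of "\<lambda>z. k ((1/2) *\<^sub>R z) * ?G (r *\<^sub>R z)" 2 0]
    by (simp add: mult.commute)
  also have "\<dots> \<le> 2 ^ ?n * (\<integral>z. 2 * (k z * ?G (r *\<^sub>R z)) \<partial>lborel)"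
  proof (intro mult_left_mono integral_mono)
    fix z
    have "?G ((2 * r) *\<^sub>R z) \<le> 2 * ?G (r *\<^sub>R z)"
      using interaction_distinct_multiple[of 2 "r *\<^sub>R z"] by simp
    then show "k z * ?G ((2 * r) *\<^sub>R z) \<le> 2 * (k z * ?G (r *\<^sub>R z))"
      using mult_left_mono[OF _ k_nonneg[of z]] by fastforce
  qed (use int_G in auto)
  also have "\<dots> = 2 ^ ?n * 2 * (\<integral>z. k z * ?G (r *\<^sub>R z) \<partial>lborel)" by simp
  also have "\<dots> \<le> 2 ^ ?n * 2 * (?S r / c0)"
  proof (intro mult_left_mono)
    have "(\<integral>z. c0 * (k z * ?G (r *\<^sub>R z)) \<partial>lborel) \<le> ?S r"
    proof (intro integral_mono)
      show "c0 * (k z * ?G (r *\<^sub>R z)) \<le> k z * symmetric_interaction (r *\<^sub>R z)" for z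
        using mult_left_mono[OF distinct_le_symmetric_interaction[of "r *\<^sub>R z"] k_nonneg[of z]]
        by (simp add: mult.left_commute)
    qed (use int_G int_S in auto)
    then show "(\<integral>z. k z * ?G (r *\<^sub>R z) \<partial>lborel) \<le> ?S r / c0"
      using c0_pos by (simp add: field_simps)
  qed auto
  finally have half: "(\<integral>z. k ((1/2) *\<^sub>R z) * ?G (r *\<^sub>R z) \<partial>lborel) \<le> 2 ^ ?n * 2 * (?S r / c0)" .
  \<comment> \<open>The factor \<open>|r z|\<close> in the error meets the kernel decay here.\<close>
  have "?S (real N * r) \<le>
      (\<integral>z. real N * (k z * symmetric_interaction (r *\<^sub>R z)) + E * (k ((1/2) *\<^sub>R z) * ?G (r *\<^sub>R z)) \<partial>lborel)"
  proof (rule integral_mono_AE)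
    show "AE z in lborel. k z * symmetric_interaction ((real N * r) *\<^sub>R z) \<le>
      real N * (k z * symmetric_interaction (r *\<^sub>R z)) + E * (k ((1/2) *\<^sub>R z) * ?G (r *\<^sub>R z))"
      using k_decay
    proof eventually_elim
      case (elim z)
      have G: "0 \<le> ?G (r *\<^sub>R z)" by (rule interaction_nonneg[OF admissible_distinct_weight])
      have "symmetric_interaction ((real N * r) *\<^sub>R z) \<le>
          real N * symmetric_interaction (r *\<^sub>R z) + 4 * L * (real N)\<^sup>2 * norm (r *\<^sub>R z) * ?G (r *\<^sub>R z)"
        using symmetric_interaction_multiple[OF \<open>N \<ge> 1\<close>, of "r *\<^sub>R z"] by simp
      then have "k z * symmetric_interaction ((real N * r) *\<^sub>R z) \<le>
          k z * (real N * symmetric_interaction (r *\<^sub>R z) + 4 * L * (real N)\<^sup>2 * norm (r *\<^sub>R z) * ?G (r *\<^sub>R z))"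
        by (rule mult_left_mono[OF _ k_nonneg])
      also have "\<dots> = real N * (k z * symmetric_interaction (r *\<^sub>R z)) +
          4 * L * (real N)\<^sup>2 * r * (norm z * k z) * ?G (r *\<^sub>R z)"
        using \<open>0 \<le> r\<close> by (simp add: algebra_simps)
      also have "4 * L * (real N)\<^sup>2 * r * (norm z * k z) * ?G (r *\<^sub>R z) \<le>
          4 * L * (real N)\<^sup>2 * r * (cK * k ((1/2) *\<^sub>R z)) * ?G (r *\<^sub>R z)"
        using L_nonneg \<open>0 \<le> r\<close> by (intro mult_right_mono mult_left_mono elim G) auto
      finally show ?case by (simp add: E_def mult.assoc)
    qed
  qed (use int_S int_half in auto)
  also have "\<dots> = real N * ?S r + E * (\<integral>z. k ((1/2) *\<^sub>R z) * ?G (r *\<^sub>R z) \<partial>lborel)"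
    using int_S int_half by (simp add: Bochner_Integration.integral_add)
  also have "\<dots> \<le> real N * ?S r + E * (2 ^ ?n * 2 * (?S r / c0))"
    by (intro add_left_mono mult_left_mono half E)
  also have "\<dots> = (real N + 8 * L * cK * 2 ^ ?n / c0 * (real N)\<^sup>2 * r) * ?S r"
    by (simp add: E_def algebra_simps)
  finally show ?thesis
    unfolding kernel_symmetric_interaction by simp
qed

end

section \<open>The boundary of a set of class C2\<close>

text \<open>A graph is the image of the hyperplane orthogonal to \<open>e\<close> under a differentiable map.\<close>
lemma negligible_graph:
  fixes g :: "real^'n \<Rightarrow> real"
  assumes g: "\<And>x. g differentiable (at x)" and "norm e = 1"
  shows "negligible {y. y \<bullet> e = g (y - (y \<bullet> e) *\<^sub>R e)}"
proof -
  have "e \<noteq> 0" using \<open>norm e = 1\<close> by auto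
  then have "negligible {y. e \<bullet> y = 0}" by (intro negligible_hyperplane) auto
  then have "negligible ((\<lambda>y. y + g y *\<^sub>R e) ` {y. e \<bullet> y = 0})"
  proof (rule negligible_differentiable_image_negligible[rotated])
    show "(\<lambda>y. y + g y *\<^sub>R e) differentiable_on {y. e \<bullet> y = 0}"
      using g unfolding differentiable_on_def
      by (intro ballI differentiable_add differentiable_scaleR) (auto intro: differentiable_at_withinI)
  qed simp
  moreover have "{y. y \<bullet> e = g (y - (y \<bullet> e) *\<^sub>R e)} \<subseteq> (\<lambda>y. y + g y *\<^sub>R e) ` {y. e \<bullet> y = 0}"
  proof
    fix y assume "y \<in> {y. y \<bullet> e = g (y - (y \<bullet> e) *\<^sub>R e)}"
    moreover have "e \<bullet> (y - (y \<bullet> e) *\<^sub>R e) = 0"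
      using \<open>norm e = 1\<close> by (simp add: inner_diff_right inner_commute norm_eq_1)
    ultimately show "y \<in> (\<lambda>y. y + g y *\<^sub>R e) ` {y. e \<bullet> y = 0}"
      by (intro image_eqI[of _ _ "y - (y \<bullet> e) *\<^sub>R e"]) auto
  qed
  ultimately show ?thesis by (rule negligible_subset)
qed

text \<open>Near a boundary point the region below the graph is open and misses \<open>\<Omega>\<close>, so the boundary lies on
  the graph. Without this the three phases would leave part of the cell unoccupied.\<close>
lemma negligible_frontier_C2_open_set:
  fixes \<Omega> :: "(real^'n) set"
  assumes "C2_open_set \<Omega>"
  shows "negligible (frontier \<Omega>)"
proof (subst locally_negligible_alt, rule ballI)
  fix x assume x: "x \<in> frontier \<Omega>"
  have "open \<Omega>" using assms by (simp add: C2_open_set_def)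
  have "\<exists>r>0. \<exists>e g. norm e = 1 \<and> C2_fun g \<and>
      \<Omega> \<inter> ball x r = {y \<in> ball x r. y \<bullet> e > g (y - (y \<bullet> e) *\<^sub>R e)}"
    using assms x unfolding C2_open_set_def by (elim conjE bspec)
  then obtain r e g where r: "0 < r" "norm e = 1" "C2_fun g"
    and eq: "\<Omega> \<inter> ball x r = {y \<in> ball x r. y \<bullet> e > g (y - (y \<bullet> e) *\<^sub>R e)}"
    by (elim exE conjE)
  let ?p = "\<lambda>y. g (y - (y \<bullet> e) *\<^sub>R e)"
  have mem: "y \<in> \<Omega> \<longleftrightarrow> ?p y < y \<bullet> e" if "y \<in> ball x r" for y
    using eqset_imp_iff[OF eq, of y] that by (simp only: Int_iff mem_Collect_eq simp_thms)
  have diff: "g differentiable (at y)" for y using r(3) by (simp add: C2_fun_def)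
  then have "continuous_on UNIV g"
    by (intro continuous_at_imp_continuous_on ballI differentiable_imp_continuous_within)
  then have cont: "continuous_on UNIV ?p"
    by (rule continuous_on_compose2) (auto intro!: continuous_intros)
  have "frontier \<Omega> \<inter> ball x r \<subseteq> {y. y \<bullet> e = ?p y}"
  proof
    fix y assume y: "y \<in> frontier \<Omega> \<inter> ball x r"
    then have "y \<notin> \<Omega>" using \<open>open \<Omega>\<close> by (simp add: frontier_def interior_open)
    then have le: "y \<bullet> e \<le> ?p y" using y mem[of y] by (simp only: Int_iff not_less simp_thms)
    have "\<not> y \<bullet> e < ?p y"
    proof
      assume "y \<bullet> e < ?p y"
      let ?B = "ball x r \<inter> {y. y \<bullet> e < ?p y}"
      have "open ?B"
        by (intro open_Int open_ball open_Collect_less cont continuous_intros)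
      moreover have "?B \<inter> \<Omega> = {}" using mem order_less_asym by blast
      ultimately have "?B \<inter> closure \<Omega> = {}" by (simp add: open_Int_closure_eq_empty)
      then show False using y \<open>y \<bullet> e < ?p y\<close> unfolding frontier_def by blast
    qed
    then show "y \<in> {y. y \<bullet> e = ?p y}" using le by simp
  qed
  then have "negligible (frontier \<Omega> \<inter> ball x r)"
    using negligible_graph[OF diff \<open>norm e = 1\<close>] by (rule negligible_subset[rotated])
  then show "\<exists>U. openin (top_of_set (frontier \<Omega>)) U \<and> x \<in> U \<and> negligible U"
    using x \<open>0 < r\<close>
    by (intro exI[of _ "frontier \<Omega> \<inter> ball x r"] conjI openin_open_Int open_ball) simp_all
qed

section \<open>The three phases of the thresholding energy\<close>

datatype phase = Film | Vapor | Substrate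

text \<open>The boundary of \<open>\<Omega>\<close> is assigned to the substrate, so that the phases add up to \<open>1\<close> everywhere and not
  just almost everywhere.\<close>
definition phase_fun :: "(real^'n) set \<Rightarrow> (real^'n \<Rightarrow> real) \<Rightarrow> phase \<Rightarrow> real^'n \<Rightarrow> real" where
  "phase_fun \<Omega> a i = periodic_ext (case i of
     Film \<Rightarrow> a | Vapor \<Rightarrow> (\<lambda>x. indicator \<Omega> x - a x) | Substrate \<Rightarrow> (\<lambda>x. 1 - indicator \<Omega> x))"

text \<open>The energy couples each pair of phases in one order only, with the tension evaluated outside
  the convolution.\<close>
definition one_sided_tension ::
  "(real^'n \<Rightarrow> real) \<Rightarrow> (real^'n \<Rightarrow> real) \<Rightarrow> (real^'n \<Rightarrow> real) \<Rightarrow> phase \<Rightarrow> phase \<Rightarrow> real^'n \<Rightarrow> real" where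
  "one_sided_tension \<gamma>PV \<gamma>SP \<gamma>SV i j = (case (i, j) of
     (Film, Vapor) \<Rightarrow> \<gamma>PV | (Film, Substrate) \<Rightarrow> \<gamma>SP | (Vapor, Substrate) \<Rightarrow> \<gamma>SV | _ \<Rightarrow> (\<lambda>_. 0))"

lemma phase_fun_borel:
  assumes [measurable]: "\<Omega> \<in> sets borel" "a \<in> borel_measurable borel"
  shows "phase_fun \<Omega> a i \<in> borel_measurable borel"
  unfolding phase_fun_def periodic_ext_frac_vec[abs_def]
  by (cases i; simp)

lemma torus_phases_phase_fun:
  assumes "\<Omega> \<in> sets borel" "a \<in> borel_measurable borel"
    and a: "\<And>x. 0 \<le> a x" "\<And>x. a x \<le> indicator \<Omega> x"
  shows "torus_phases {Film, Vapor, Substrate} (phase_fun \<Omega> a)"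
proof
  fix i :: phase and x
  show "phase_fun \<Omega> a i \<in> borel_measurable borel" by (rule phase_fun_borel[OF assms(1,2)])
  show "lattice_periodic (phase_fun \<Omega> a i)"
    unfolding phase_fun_def by (rule lattice_periodic_periodic_ext)
  have i: "indicator \<Omega> y \<le> (1::real)" for y by (simp add: indicator_def)
  show "0 \<le> phase_fun \<Omega> a i x"
    by (cases i) (simp_all add: phase_fun_def periodic_ext_def a i)
  have "a y \<le> 1" "indicator \<Omega> y - a y \<le> 1" for y
    using a[of y] i[of y] by linarith+
  then show "phase_fun \<Omega> a i x \<le> 1"
    by (cases i) (simp_all add: phase_fun_def periodic_ext_def)
  show "(\<Sum>i\<in>{Film, Vapor, Substrate}. phase_fun \<Omega> a i x) = 1"
    by (simp add: phase_fun_def periodic_ext_def)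
qed simp

text \<open>The film and the vapour vanish off \<open>\<Omega>\<close> in the cell, so that the integral over \<open>\<Omega>\<close> is one over the whole
  torus, and all functions may be replaced by Borel functions that agree almost everywhere.\<close>
lemma thresholding_energy_eq:
  fixes \<Omega> :: "(real^'n) set" and \<gamma>PV \<gamma>SP \<gamma>SV K k a u :: "real^'n \<Rightarrow> real"
  assumes "open \<Omega>" and frontier: "negligible (frontier \<Omega>)" and cell: "closure \<Omega> \<subseteq> unit_cell"
    and [measurable]: "\<gamma>PV \<in> borel_measurable borel" "\<gamma>SP \<in> borel_measurable borel"
      "\<gamma>SV \<in> borel_measurable borel" "k \<in> borel_measurable borel" "a \<in> borel_measurable borel"
    and k: "AE x in lborel. K x = k x"
    and a: "AE x in lebesgue. x \<in> \<Omega> \<longrightarrow> u x = a x" "\<And>x. x \<notin> \<Omega> \<Longrightarrow> a x = 0"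
    and "0 < h"
  defines "U \<equiv> phase_fun \<Omega> a" and "V \<equiv> \<lambda>j x. \<integral>z. k z * phase_fun \<Omega> a j (x - sqrt h *\<^sub>R z) \<partial>lborel"
  shows "thresholding_energy \<Omega> K \<gamma>PV \<gamma>SP \<gamma>SV h u = 1 / sqrt h *
    (\<integral>x. \<gamma>PV x * U Film x * V Vapor x + \<gamma>SP x * U Film x * V Substrate x +
       \<gamma>SV x * U Vapor x * V Substrate x \<partial>cell_measure)"
proof -
  have [measurable]: "\<Omega> \<in> sets borel" using \<open>open \<Omega>\<close> by simp
  have [measurable]: "U i \<in> borel_measurable borel" for i
    unfolding U_def by (rule phase_fun_borel) measurable
  have [measurable]: "V i \<in> borel_measurable borel" for i
    unfolding V_def U_def[symmetric] by measurable
  have sub: "\<Omega> \<subseteq> unit_cell" using cell closure_subset by blast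
  have AE: "AE x in lborel. periodic_ext (\<lambda>y. indicator \<Omega> y - zero_ext \<Omega> u y) x = U Vapor x"
    "AE x in lborel. periodic_ext (indicator (solid \<Omega>)) x = U Substrate x"
  proof -
    have "AE x in lebesgue. periodic_ext (\<lambda>y. indicator \<Omega> y - zero_ext \<Omega> u y) x = U Vapor x"
      unfolding U_def phase_fun_def phase.case
    proof (rule AE_periodic_ext)
      show "AE x in lebesgue. x \<in> unit_cell \<longrightarrow> indicator \<Omega> x - zero_ext \<Omega> u x = indicator \<Omega> x - a x"
        using a(1) by eventually_elim (simp add: zero_ext_def a(2))
    qed
    then show "AE x in lborel. periodic_ext (\<lambda>y. indicator \<Omega> y - zero_ext \<Omega> u y) x = U Vapor x"
      by (simp add: AE_completion_iff)
    have "AE x in lebesgue. x \<notin> frontier \<Omega>"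
      using frontier by (intro AE_not_in) (simp add: negligible_iff_null_sets)
    then have "AE x in lebesgue. x \<in> unit_cell \<longrightarrow>
        indicator (solid \<Omega>) x = (1 - indicator \<Omega> x :: real)"
      by eventually_elim
         (use \<open>open \<Omega>\<close> closure_subset[of \<Omega>] in
           \<open>auto simp: solid_def frontier_def interior_open indicator_def\<close>)
    then have "AE x in lebesgue. periodic_ext (indicator (solid \<Omega>)) x = U Substrate x"
      unfolding U_def phase_fun_def phase.case by (rule AE_periodic_ext)
    then show "AE x in lborel. periodic_ext (indicator (solid \<Omega>)) x = U Substrate x"
      by (simp add: AE_completion_iff)
  qed
  have conv: "convol (scaled_kernel K h) (periodic_ext (\<lambda>y. indicator \<Omega> y - zero_ext \<Omega> u y)) x = V Vapor x"
    "convol (scaled_kernel K h) (periodic_ext (indicator (solid \<Omega>))) x = V Substrate x" for x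
    unfolding V_def U_def[symmetric]
    by (intro convol_scaled_kernel k AE \<open>0 < h\<close>; measurable)+
  have pt: "indicator \<Omega> x * (\<gamma>PV x * u x * V Vapor x + \<gamma>SP x * u x * V Substrate x
        + \<gamma>SV x * (1 - u x) * V Substrate x) =
      indicator unit_cell x * (\<gamma>PV x * U Film x * V Vapor x + \<gamma>SP x * U Film x * V Substrate x +
       \<gamma>SV x * U Vapor x * V Substrate x)" if "x \<in> \<Omega> \<longrightarrow> u x = a x" for x
    using that a(2)[of x] sub frac_vec_unit_cell[of x]
    by (auto simp: indicator_def U_def phase_fun_def periodic_ext_frac_vec)
  have "(LINT x:\<Omega>|lebesgue. \<gamma>PV x * u x * V Vapor x + \<gamma>SP x * u x * V Substrate x
        + \<gamma>SV x * (1 - u x) * V Substrate x) =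
    (\<integral>x. indicator unit_cell x * (\<gamma>PV x * U Film x * V Vapor x + \<gamma>SP x * U Film x * V Substrate x +
       \<gamma>SV x * U Vapor x * V Substrate x) \<partial>lborel)"
    unfolding set_lebesgue_integral_def real_scaleR_def
  proof (rule lebesgue_integral_eq_lborel_AE)
    show "AE x in lebesgue. indicator \<Omega> x * (\<gamma>PV x * u x * V Vapor x + \<gamma>SP x * u x * V Substrate x
        + \<gamma>SV x * (1 - u x) * V Substrate x) =
      indicator unit_cell x * (\<gamma>PV x * U Film x * V Vapor x + \<gamma>SP x * U Film x * V Substrate x +
       \<gamma>SV x * U Vapor x * V Substrate x)"
      using a(1) by eventually_elim (rule pt)
  qed measurable
  also have "\<dots> = (\<integral>x. \<gamma>PV x * U Film x * V Vapor x + \<gamma>SP x * U Film x * V Substrate x +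
       \<gamma>SV x * U Vapor x * V Substrate x \<partial>cell_measure)"
    by (rule integral_cell[symmetric]) measurable
  finally show ?thesis
    unfolding thresholding_energy_def conv by (rule arg_cong)
qed

lemma lebesgue_borel_representative_01:
  fixes u :: "'a::euclidean_space \<Rightarrow> real"
  assumes [measurable]: "\<Omega> \<in> sets borel" and "set_borel_measurable lebesgue \<Omega> u"
    and "AE x in lebesgue. x \<in> \<Omega> \<longrightarrow> 0 \<le> u x \<and> u x \<le> 1"
  obtains a where "a \<in> borel_measurable borel" "\<And>x. 0 \<le> a x" "\<And>x. a x \<le> indicator \<Omega> x"
    "AE x in lebesgue. x \<in> \<Omega> \<longrightarrow> u x = a x"
proof -
  obtain b where [measurable]: "b \<in> borel_measurable borel"
    and b: "AE x in lborel. indicator \<Omega> x * u x = b x"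
    using completion_ex_borel_measurable_real[of "\<lambda>x. indicator \<Omega> x * u x" lborel] assms(2)
    by (auto simp: set_borel_measurable_def)
  \<comment> \<open>Clipping makes the bounds hold everywhere and changes the function only on a null set.\<close>
  let ?a = "\<lambda>x. indicator \<Omega> x * max 0 (min 1 (b x))"
  have "AE x in lebesgue. x \<in> \<Omega> \<longrightarrow> u x = ?a x"
    using AE_completion[OF b] assms(3) by eventually_elim auto
  then show ?thesis
    by (intro that[of ?a]) (measurable, auto simp: indicator_def)
qed

text \<open>Symmetry and decay pass to the representative almost everywhere, because reflection and halving
  preserve null sets.\<close>
lemma kernel_borel_representative:
  fixes K :: "'a::euclidean_space \<Rightarrow> real"
  assumes nonneg: "\<And>x. 0 \<le> K x" and int: "integrable lebesgue K"
    and even: "\<And>x. K (- x) = K x" and decay: "\<And>x. norm x * K x \<le> cK * K ((1/2) *\<^sub>R x)"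
  obtains k where "k \<in> borel_measurable borel" "integrable lborel k" "\<And>x. 0 \<le> k x"
    "AE x in lborel. K x = k x" "AE x in lborel. k (- x) = k x"
    "AE x in lborel. norm x * k x \<le> cK * k ((1/2) *\<^sub>R x)"
proof -
  obtain b where [measurable]: "b \<in> borel_measurable borel" and b: "AE x in lborel. K x = b x"
    using completion_ex_borel_measurable_real[of K lborel] int by auto
  define k where "k x = max 0 (b x)" for x
  have k[measurable]: "k \<in> borel_measurable borel" unfolding k_def[abs_def] by measurable
  have eq: "AE x in lborel. K x = k x"
    using b by eventually_elim (metis k_def max.absorb2 nonneg)
  have "integrable lebesgue k \<longleftrightarrow> integrable lebesgue K"
    using int eq by (intro integrable_cong_AE) (auto intro: measurable_completion simp: AE_completion_iff)
  then have "integrable lborel k" using int by (simp add: integrable_completion)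
  moreover have "AE x in lborel. K (0 + (- 1) *\<^sub>R x) = k (0 + (- 1) *\<^sub>R x)"
    by (rule AE_lborel_affine[OF eq]) simp
  then have "AE x in lborel. k (- x) = k x"
    using eq by eventually_elim (use even in \<open>simp add: eq_commute\<close>)
  moreover have "AE x in lborel. K (0 + (1/2) *\<^sub>R x) = k (0 + (1/2) *\<^sub>R x)"
    by (rule AE_lborel_affine[OF eq]) simp
  then have "AE x in lborel. norm x * k x \<le> cK * k ((1/2) *\<^sub>R x)"
    using eq by eventually_elim (use decay in \<open>metis add_0\<close>)
  ultimately show ?thesis
    using k eq by (intro that[of k]) (auto simp: k_def)
qed

lemma lipschitz_torus_common_constant:
  fixes f g h :: "real^'n \<Rightarrow> real"
  assumes "lipschitz_torus f" "lipschitz_torus g" "lipschitz_torus h"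
  obtains L where "0 \<le> L" "\<And>x y. f x \<le> f y + L * norm (x - y)"
    "\<And>x y. g x \<le> g y + L * norm (x - y)" "\<And>x y. h x \<le> h y + L * norm (x - y)"
proof -
  obtain A B C where ABC: "A-lipschitz_on UNIV f" "B-lipschitz_on UNIV g" "C-lipschitz_on UNIV h"
    using assms by (auto simp: lipschitz_torus_def)
  let ?L = "max A (max B C)"
  have bound: "k x \<le> k y + ?L * norm (x - y)" if "M-lipschitz_on UNIV k" "M \<le> ?L" for M k x y
    using lipschitz_onD[OF lipschitz_on_le[OF that], of x y] by (simp add: dist_norm abs_le_iff)
  note bound[OF ABC(1)] bound[OF ABC(2)] bound[OF ABC(3)]
  moreover have "0 \<le> ?L" using lipschitz_on_nonneg[OF ABC(1)] by simp
  ultimately show ?thesis by (intro that[of ?L]) simp_all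
qed

lemma lipschitz_torus_borel: "lipschitz_torus f \<Longrightarrow> f \<in> borel_measurable borel"
  by (auto simp: lipschitz_torus_def intro: borel_measurable_continuous_onI lipschitz_on_continuous_on)

theorem lemma4p3:
  fixes \<Omega> :: "(real^'n) set"
    and K \<gamma>PV \<gamma>SP \<gamma>SV :: "real^'n \<Rightarrow> real"
    and c0 C0 cK :: real
  assumes \<Omega>_C2: "C2_open_set \<Omega>"
    and \<Omega>_connected: "connected \<Omega>"
    and \<Omega>_compactly_contained: "closure \<Omega> \<subseteq> {x. \<forall>i. 0 < x $ i \<and> x $ i < 1}"
    and \<gamma>_lipschitz: "lipschitz_torus \<gamma>PV" "lipschitz_torus \<gamma>SP" "lipschitz_torus \<gamma>SV"
    and \<gamma>_bounds: "0 < c0" "c0 \<le> C0"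
      "\<And>x. c0 \<le> \<gamma>PV x \<and> \<gamma>PV x \<le> C0"
      "\<And>x. c0 \<le> \<gamma>SP x \<and> \<gamma>SP x \<le> C0"
      "\<And>x. c0 \<le> \<gamma>SV x \<and> \<gamma>SV x \<le> C0"
    and \<gamma>_triangle:
      "\<And>x. \<gamma>PV x \<le> \<gamma>SP x + \<gamma>SV x"
      "\<And>x. \<gamma>SP x \<le> \<gamma>PV x + \<gamma>SV x"
      "\<And>x. \<gamma>SV x \<le> \<gamma>PV x + \<gamma>SP x"
    and K_nonneg: "\<And>x. 0 \<le> K x"
    and K_L1: "integrable lebesgue K"
    and K_even: "\<And>x. K (- x) = K x"
    and K_integral: "(LINT x|lebesgue. K x) = 1"
    and cK_pos: "0 < cK"
    and K_decay: "\<And>x. norm x * K x \<le> cK * K ((1/2) *\<^sub>R x)"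
  shows "\<exists>c>0. \<forall>u\<in>BV01 \<Omega>. \<forall>h>0. \<forall>N::nat. N \<ge> 1 \<longrightarrow>
           thresholding_energy \<Omega> K \<gamma>PV \<gamma>SP \<gamma>SV ((real N)\<^sup>2 * h) u
             \<le> (1 + c * real N * sqrt h) * thresholding_energy \<Omega> K \<gamma>PV \<gamma>SP \<gamma>SV h u"
proof -
  have "open \<Omega>" using \<Omega>_C2 by (simp add: C2_open_set_def)
  have frontier: "negligible (frontier \<Omega>)"
    by (rule negligible_frontier_C2_open_set[OF \<Omega>_C2])
  have cell: "closure \<Omega> \<subseteq> unit_cell"
    using \<Omega>_compactly_contained by (auto simp: unit_cell_def intro: less_imp_le)
  have \<Omega>_borel: "\<Omega> \<in> sets borel" using \<open>open \<Omega>\<close> by simp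
  obtain L where L: "0 \<le> L" "\<And>x y. \<gamma>PV x \<le> \<gamma>PV y + L * norm (x - y)"
    "\<And>x y. \<gamma>SP x \<le> \<gamma>SP y + L * norm (x - y)" "\<And>x y. \<gamma>SV x \<le> \<gamma>SV y + L * norm (x - y)"
    using lipschitz_torus_common_constant[OF \<gamma>_lipschitz] by blast
  obtain k where k: "k \<in> borel_measurable borel" "integrable lborel k" "\<And>x. 0 \<le> k x"
    "AE x in lborel. K x = k x" "AE x in lborel. k (- x) = k x"
    "AE x in lborel. norm x * k x \<le> cK * k ((1/2) *\<^sub>R x)"
    using kernel_borel_representative[OF K_nonneg K_L1 K_even K_decay] by blast
  let ?w = "one_sided_tension \<gamma>PV \<gamma>SP \<gamma>SV" and ?I = "{Film, Vapor, Substrate}"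
  note \<gamma>_borel = \<gamma>_lipschitz[THEN lipschitz_torus_borel]
  have \<gamma>_periodic: "lattice_periodic \<gamma>PV" "lattice_periodic \<gamma>SP" "lattice_periodic \<gamma>SV"
    using \<gamma>_lipschitz by (auto simp: lipschitz_torus_def intro: periodic_imp_lattice_periodic)
  have \<gamma>_nonneg: "0 \<le> \<gamma>PV x" "0 \<le> \<gamma>SP x" "0 \<le> \<gamma>SV x" for x
    using \<gamma>_bounds by (meson less_imp_le order_trans)+
  let ?A = "8 * L * cK * 2 ^ CARD('n) / c0"
  \<comment> \<open>The summand \<open>1\<close> keeps the constant positive when the tensions are constant and \<open>L = 0\<close>.\<close>
  define c where "c = ?A + 1"
  have A: "0 \<le> ?A" using L(1) cK_pos \<gamma>_bounds(1) by simp
  have "thresholding_energy \<Omega> K \<gamma>PV \<gamma>SP \<gamma>SV ((real N)\<^sup>2 * h) u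
      \<le> (1 + c * real N * sqrt h) * thresholding_energy \<Omega> K \<gamma>PV \<gamma>SP \<gamma>SV h u"
    if u: "u \<in> BV01 \<Omega>" and "0 < h" and N: "N \<ge> 1" for u h and N :: nat
  proof -
    have "set_borel_measurable lebesgue \<Omega> u"
      using u by (auto simp: BV01_def BV_def set_integrable_def set_borel_measurable_def)
    moreover have "AE x in lebesgue. x \<in> \<Omega> \<longrightarrow> 0 \<le> u x \<and> u x \<le> 1"
      using u by (simp add: BV01_def)
    ultimately obtain a where a: "a \<in> borel_measurable borel" "\<And>x. 0 \<le> a x"
      "\<And>x. a x \<le> indicator \<Omega> x" "AE x in lebesgue. x \<in> \<Omega> \<longrightarrow> u x = a x"
      using lebesgue_borel_representative_01[OF \<Omega>_borel] by blast
    have a0: "a x = 0" if "x \<notin> \<Omega>" for x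
      using a(2)[of x] a(3)[of x] that by simp
    interpret torus_phases ?I "phase_fun \<Omega> a"
      by (rule torus_phases_phase_fun[OF \<Omega>_borel a(1-3)])
    have adm: "admissible ?w"
      unfolding admissible_def
    proof (intro allI)
      fix i j
      have "?w i j x \<le> C0" for x
        using \<gamma>_bounds order_trans[of 0 c0 C0]
        by (cases i; cases j) (auto simp: one_sided_tension_def)
      then have "\<exists>B. \<forall>x. ?w i j x \<le> B" by blast
      then show "?w i j \<in> borel_measurable borel \<and> lattice_periodic (?w i j) \<and>
          (\<forall>x. 0 \<le> ?w i j x) \<and> (\<exists>B. \<forall>x. ?w i j x \<le> B)"
        using \<gamma>_borel \<gamma>_periodic \<gamma>_nonneg
        by (cases i; cases j) (auto simp: one_sided_tension_def lattice_periodic_def)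
    qed
    interpret thresholding ?I "phase_fun \<Omega> a" ?w L c0 k cK
    proof
      show "?w i j x \<le> ?w i j y + L * norm (x - y) * distinct_weight i j x" for i j x y
        using L by (cases i; cases j) (auto simp: one_sided_tension_def distinct_weight_def)
      show "(\<forall>x. c0 \<le> ?w i j x) \<or> (\<forall>x. c0 \<le> ?w j i x)" if "i \<in> ?I" "j \<in> ?I" "i \<noteq> j" for i j
        using that \<gamma>_bounds by (cases i; cases j) (auto simp: one_sided_tension_def)
      show "?w i j x + ?w j i x \<le> (?w i l x + ?w l i x) + (?w l j x + ?w j l x)"
        if "i \<in> ?I" "j \<in> ?I" "l \<in> ?I" for i j l x
        using \<gamma>_triangle[of x] \<gamma>_nonneg[of x]
        by (cases i; cases j; cases l) (simp_all add: one_sided_tension_def)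
    qed (use adm \<gamma>_bounds(1) L(1) k cK_pos in auto)
    let ?F = "\<lambda>r. \<integral>z. k z * interaction ?w (r *\<^sub>R z) \<partial>lborel"
    have energy: "thresholding_energy \<Omega> K \<gamma>PV \<gamma>SP \<gamma>SV s u = 1 / sqrt s * ?F (sqrt s)"
      if "0 < s" for s
      using thresholding_energy_eq[OF \<open>open \<Omega>\<close> frontier cell \<gamma>_borel k(1) a(1) k(4) a(4) a0 that]
      unfolding kernel_interaction_eq[OF adm]
      by (simp add: one_sided_tension_def add.assoc)
    define r where "r = sqrt h"
    have r: "0 < r" "sqrt ((real N)\<^sup>2 * h) = real N * r"
      using \<open>0 < h\<close> by (simp_all add: r_def real_sqrt_mult)
    have F_nonneg: "0 \<le> ?F r"
      by (intro Bochner_Integration.integral_nonneg mult_nonneg_nonneg k(3) interaction_nonneg adm)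
    have "?F (real N * r) \<le> (real N + ?A * (real N)\<^sup>2 * r) * ?F r"
      using kernel_interaction_dilation[of r N] r(1) N by simp
    also have "\<dots> \<le> (real N + c * (real N)\<^sup>2 * r) * ?F r"
      using r(1) F_nonneg by (intro mult_right_mono add_left_mono) (auto simp: c_def)
    also have "\<dots> = (real N * r) * ((1 + c * real N * r) * (1 / r * ?F r))"
      using r(1) by (simp add: field_simps power2_eq_square)
    finally have "1 / (real N * r) * ?F (real N * r) \<le> (1 + c * real N * r) * (1 / r * ?F r)"
      using r(1) N by (simp add: pos_divide_le_eq mult.commute)
    then show ?thesis
      using energy[of h] energy[of "(real N)\<^sup>2 * h"] \<open>0 < h\<close> N r by (simp add: r_def)
  qed
  moreover have "0 < c" using A by (simp add: c_def)
  ultimately show ?thesis by blast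
qed

end
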